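(* Let $K$ be a random convex body of $\mathbb R^2$ containing the origin, whose law is invariant under all rotations, and whose diameter is almost surely bounded by a constant $D>0$. For the planar Boolean model with i.i.d. grains distributed as $K$, the total visibility $\mathfrak V$ satisfies $$\lim_{r\to+\infty}\frac1r\,\log\mathbb P\left(\mathfrak V\ge r\right)=-\mathbb E[\mathbf W(K)],$$ where $\mathbf W(K)$ denotes the mean width of $K$.
   Context: Let $\mathbf X$ be a homogeneous Poisson point process in $\mathbb R^2$ with intensity measure the Lebesgue measure, and let $(K_x)_{x\in\mathbf X}$ be i.i.d. copies of $K$, independent of $\mathbf X$. The occupied phase is $\mathfrak O=\bigcup_{x\in\mathbf X}(x\oplus K_x)$, where $x\oplus K_x=\{x+y:y\in K_x\}$. The model is conditioned on the event $\{O\notin\mathfrak O\}$ (of positive probability), where $O$ is the origin; $\mathbb P$ denotes the probability under this conditioning. For a unit vector $\mathbf u$, $V(\mathbf u)=\inf\{s>0: s\mathbf u\in\mathfrak O\}$ (with $\inf\emptyset=+\infty$), and the total visibility is $\mathfrak V=\sup_{\|\mathbf u\|=1}V(\mathbf u)$. For a convex body $L\subset\mathbb R^2$ and a unit vector $\mathbf u$, let $\mathbf v$ be a unit vector orthogonal to $\mathbf u$ and $W_u(L)=\sup_{x,y\in L}\langle y-x,\mathbf v\rangle$ (the width of $L$ in the direction orthogonal to $\mathbf u$). The mean width is $\mathbf W(L)=\frac1{2\pi}\int_{\mathbb S^1}W_u(L)\,\mathrm d\sigma(u)$, where $\sigma$ is the uniform (arc-length) measure on the unit circle, of total mass $2\pi$.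 *)

theory Defs
  imports "HOL-Probability.Probability"
begin

text \<open>Convex bodies are nonempty compact convex sets; no interior point is required. They carry
  the sigma-algebra generated by the hitting events of open sets (the Effros sigma-algebra), which
  coincides with the Borel sigma-algebra of the Hausdorff metric.\<close>

definition convex_body :: "'a::euclidean_space set \<Rightarrow> bool" where
  "convex_body L \<longleftrightarrow> compact L \<and> convex L \<and> L \<noteq> {}"

definition convex_bodies :: "'a::euclidean_space set measure" where
  "convex_bodies =
     sigma {L. convex_body L} ((\<lambda>G. {L. convex_body L \<and> L \<inter> G \<noteq> {}}) ` {G. open G})"

text \<open>A homogeneous Poisson point process of unit intensity, as a random locally finite set whose
  counts on bounded Borel sets are Poisson and on disjoint sets independent. Finite families of
  disjoint sets are covered by padding with the empty set.\<close>

definition unit_poisson_process :: "'w measure \<Rightarrow> ('w \<Rightarrow> 'a::euclidean_space set) \<Rightarrow> bool" where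
  "unit_poisson_process M X \<longleftrightarrow>
     (AE \<omega> in M. \<forall>B. bounded B \<longrightarrow> finite (X \<omega> \<inter> B)) \<and>
     (\<forall>A. A \<in> sets borel \<and> bounded A \<longrightarrow>
        (\<lambda>\<omega>. card (X \<omega> \<inter> A)) \<in> measurable M (count_space UNIV) \<and>
        (\<forall>k. measure M {\<omega> \<in> space M. card (X \<omega> \<inter> A) = k}
               = measure lborel A ^ k / fact k * exp (- measure lborel A))) \<and>
     (\<forall>A :: nat \<Rightarrow> 'a set. (\<forall>i. A i \<in> sets borel \<and> bounded (A i)) \<and> disjoint_family A \<longrightarrow>
        prob_space.indep_vars M (\<lambda>_. count_space UNIV) (\<lambda>i \<omega>. card (X \<omega> \<inter> A i)) UNIV)"

text \<open>The points of a (random) set \<open>X\<close> receive i.i.d. grains with the law \<open>Q\<close>, independent of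
  \<open>X\<close>. As usual for marked processes, this is expressed through a measurable enumeration \<open>x\<close> of the
  points, \<open>Z n\<close> being the grain of the point \<open>x n\<close>. Independence of the two sequences is stated for
  the sigma-algebras they generate, as \<open>indep_var\<close> requires both variables to have the same type.\<close>

definition iid_grains ::
  "'w measure \<Rightarrow> ('w \<Rightarrow> 'a::euclidean_space set) \<Rightarrow> 'a set measure
    \<Rightarrow> (nat \<Rightarrow> 'w \<Rightarrow> 'a) \<Rightarrow> (nat \<Rightarrow> 'w \<Rightarrow> 'a set) \<Rightarrow> bool" where
  "iid_grains M X Q x Z \<longleftrightarrow>
     (\<forall>n. x n \<in> borel_measurable M) \<and>
     (AE \<omega> in M. bij_betw (\<lambda>n. x n \<omega>) UNIV (X \<omega>)) \<and>
     (\<forall>n. Z n \<in> measurable M convex_bodies \<and> distr M convex_bodies (Z n) = Q) \<and>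
     prob_space.indep_vars M (\<lambda>_. convex_bodies) Z UNIV \<and>
     prob_space.indep_set M
       (sets (vimage_algebra (space M) (\<lambda>\<omega> n. x n \<omega>) (Pi\<^sub>M UNIV (\<lambda>_. borel))))
       (sets (vimage_algebra (space M) (\<lambda>\<omega> n. Z n \<omega>) (Pi\<^sub>M UNIV (\<lambda>_. convex_bodies))))"

definition occupied :: "(nat \<Rightarrow> 'a::euclidean_space) \<Rightarrow> (nat \<Rightarrow> 'a set) \<Rightarrow> 'a set" where
  "occupied x Z = (\<Union>n. {x n + y | y. y \<in> Z n})"

definition visibility :: "'a::euclidean_space set \<Rightarrow> 'a \<Rightarrow> ereal" where
  "visibility Occ u = Inf {ereal s | s. s > 0 \<and> s *\<^sub>R u \<in> Occ}"

definition total_visibility :: "'a::euclidean_space set \<Rightarrow> ereal" where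
  "total_visibility Occ = (SUP u\<in>{u. norm u = 1}. visibility Occ u)"

text \<open>The width does not depend on which of the two unit vectors orthogonal to \<open>u\<close> is used, since
  the supremum is symmetric under exchanging \<open>x\<close> and \<open>y\<close>.\<close>

definition perp :: "real^2 \<Rightarrow> real^2" where
  "perp u = vector [- u $ 2, u $ 1]"

definition width_orth :: "real^2 \<Rightarrow> (real^2) set \<Rightarrow> real" where
  "width_orth u L = Sup {(y - x) \<bullet> perp u | x y. x \<in> L \<and> y \<in> L}"

definition arc_length_measure :: "(real^2) measure" where
  "arc_length_measure =
     distr (restrict_space lborel {0..<2 * pi}) borel (\<lambda>t. vector [cos t, sin t])"

definition mean_width :: "(real^2) set \<Rightarrow> real" where
  "mean_width L = 1 / (2 * pi) * (\<integral>u. width_orth u L \<partial>arc_length_measure)"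

end

theory Submission
  imports Defs
begin

text \<open>By the marking theorem the probability that no grain hits given compact sets is \<open>exp (- a)\<close>, where
  \<open>a\<close> is the expected area of the set of positions at which a typical grain hits them. A segment of
  length \<open>r\<close> gives \<open>a \<le> (r + 2 D) E W\<close>, hence the lower bound. For the upper bound cut the circle
  into about \<open>r\<^sup>2\<close> arcs. If some ray of length \<open>r\<close> in an arc is free, then no grain hits both boundary
  rays of the arc, since by convexity such a grain would block the whole arc. The two boundary rays
  are so close that the grains hitting both still have expected area \<open>r E W - o(r)\<close>, and the number of
  arcs does not affect the exponential rate.\<close>

subsection \<open>Measurability of hitting events\<close>

text \<open>The visibility event ranges over uncountably many directions, so single rays allow no
  union bound; grains hitting both sides of an arc replace it by finitely many events. The order
  \<open>r ^ 2\<close> of the number \<open>m\<close> of arcs is a compromise: two segments of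
  length about \<open>r\<close> at angle \<open>2 * pi / m\<close> end at heights differing by about
  \<open>2 * pi * r / m\<close>, which is lost from the width of the grain, so \<open>m\<close> must
  grow faster than \<open>r\<close>; but the factor \<open>m\<close> of the union bound contributes
  \<open>ln m / r\<close>, which must vanish. Any power of \<open>r\<close> above the first would
  do. Rotation invariance enters twice: every arc can be turned to start at angle 0, where widths
  are vertical extents, and with Fubini it turns the expected mean width into the expected width
  across one fixed direction. Conditioning divides by a fixed positive probability and is invisible
  after division by \<open>r\<close>. Since a supremum over directions is not evidently measurable
  for \<open>M\<close>, probabilities are taken in \<open>completion M\<close>, where the event
  differs by a null set from a countable combination of free-segment events.\<close>

definition hits :: "'a::euclidean_space set \<Rightarrow> 'a \<Rightarrow> 'a set \<Rightarrow> bool" where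
  "hits S y L \<longleftrightarrow> (\<exists>z\<in>L. y + z \<in> S)"

lemma space_convex_bodies: "space convex_bodies = {L. convex_body L}"
  unfolding convex_bodies_def by (rule space_measure_of) auto

lemma sets_convex_bodies:
  "sets convex_bodies =
    sigma_sets {L. convex_body L} ((\<lambda>G. {L. convex_body L \<and> L \<inter> G \<noteq> {}}) ` {G. open G})"
  unfolding convex_bodies_def by (rule sets_measure_of) auto

lemma hit_open_in_sets:
  assumes "open G"
  shows "{L \<in> space convex_bodies. L \<inter> G \<noteq> {}} \<in> sets convex_bodies"
  unfolding sets_convex_bodies space_convex_bodies
  by (rule sigma_sets.Basic) (use assms in auto)

lemma measurable_convex_bodiesI:
  fixes f :: "'w \<Rightarrow> 'b::euclidean_space set"
  assumes "\<And>\<omega>. \<omega> \<in> space M \<Longrightarrow> convex_body (f \<omega>)"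
    and "\<And>G. open G \<Longrightarrow> {\<omega> \<in> space M. f \<omega> \<inter> G \<noteq> {}} \<in> sets M"
  shows "f \<in> measurable M convex_bodies"
  unfolding convex_bodies_def
proof (rule measurable_measure_of)
  show "f \<in> space M \<rightarrow> {L. convex_body L}" using assms(1) by auto
  fix Y assume "Y \<in> (\<lambda>G. {L. convex_body L \<and> L \<inter> G \<noteq> {}}) ` {G :: 'b set. open G}"
  then obtain G where G: "open G" "Y = {L. convex_body L \<and> L \<inter> G \<noteq> {}}" by auto
  have "f -` Y \<inter> space M = {\<omega> \<in> space M. f \<omega> \<inter> G \<noteq> {}}"
    unfolding G(2) using assms(1) by auto
  thus "f -` Y \<inter> space M \<in> sets M" using assms(2)[OF G(1)] by simp
qed auto

text \<open>The sigma-algebra only sees hits of open sets, while \<open>S\<close> is closed. As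
  \<open>L\<close> is compact and \<open>S\<close> closed, a hit means that the distance between
  \<open>y + L\<close> and \<open>S\<close> is 0, i.e. that for each tolerance some point
  \<open>q\<close> of a countable dense set is close to \<open>L\<close> with \<open>y + q\<close>
  close to \<open>S\<close>. Each such condition is a measurable rectangle in
  \<open>(y, L)\<close>.\<close>

lemma hits_measurable:
  fixes S :: "'a::euclidean_space set"
  assumes "closed S"
  shows "{p \<in> space (borel \<Otimes>\<^sub>M convex_bodies). hits S (fst p) (snd p)}
    \<in> sets (borel \<Otimes>\<^sub>M convex_bodies)"
proof (cases "S = {}")
  case True
  then show ?thesis by (simp add: hits_def)
next
  case False
  obtain Q :: "'a set" where Q: "countable Q" "\<And>U. open U \<Longrightarrow> U \<noteq> {} \<Longrightarrow> \<exists>q\<in>Q. q \<in> U"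
    using countable_dense_exists by metis
  let ?e = "\<lambda>k::nat. 1 / real (Suc k)"
  have eq: "hits S y L \<longleftrightarrow> (\<forall>k. \<exists>q\<in>Q. infdist (y + q) S < ?e k \<and> L \<inter> ball q (?e k) \<noteq> {})"
    if "convex_body L" for y L
  proof
    assume "hits S y L"
    then obtain z where z: "z \<in> L" "y + z \<in> S" by (auto simp: hits_def)
    show "\<forall>k. \<exists>q\<in>Q. infdist (y + q) S < ?e k \<and> L \<inter> ball q (?e k) \<noteq> {}"
    proof
      fix k
      obtain q where q: "q \<in> Q" "q \<in> ball z (?e k)" 
        using Q(2)[of "ball z (?e k)"] by (auto simp del: mem_ball)
      have "infdist (y + q) S \<le> dist (y + q) (y + z)"
        by (rule infdist_le) (fact z)
      also have "\<dots> < ?e k" using q by (simp add: dist_commute)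
      finally have "infdist (y + q) S < ?e k" .
      moreover have "z \<in> L \<inter> ball q (?e k)" using q z(1) by (simp add: dist_commute)
      ultimately show "\<exists>q\<in>Q. infdist (y + q) S < ?e k \<and> L \<inter> ball q (?e k) \<noteq> {}"
        using q(1) by blast
    qed
  next
    assume *: "\<forall>k. \<exists>q\<in>Q. infdist (y + q) S < ?e k \<and> L \<inter> ball q (?e k) \<noteq> {}"
    have "compact L" "L \<noteq> {}" using that by (auto simp: convex_body_def)
    moreover have "continuous_on L (\<lambda>z. infdist (y + z) S)"
      by (intro continuous_intros)
    ultimately obtain z where z: "z \<in> L" "\<And>z'. z' \<in> L \<Longrightarrow> infdist (y + z) S \<le> infdist (y + z') S"
      using continuous_attains_inf[of L] by metis
    \<comment> \<open>One \<open>?e k\<close> for the distance of \<open>y + q\<close> from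
      \<open>S\<close>, one for the distance of \<open>q\<close> from \<open>L\<close>.\<close>
    have "infdist (y + z) S \<le> 2 * ?e k" for k
    proof -
      obtain q z' where q: "infdist (y + q) S < ?e k" "z' \<in> L" "dist q z' < ?e k"
        using *[rule_format, of k] by (metis IntE disjoint_iff mem_ball)
      have "infdist (y + z) S \<le> infdist (y + z') S" using z q by auto
      also have "\<dots> \<le> infdist (y + q) S + dist (y + z') (y + q)" by (rule infdist_triangle)
      also have "\<dots> \<le> 2 * ?e k" using q by (simp add: dist_commute)
      finally show ?thesis .
    qed
    moreover have "(\<lambda>k. 2 * ?e k) \<longlonglongrightarrow> 0" by real_asymp
    ultimately have "infdist (y + z) S \<le> 0"
      by (intro LIMSEQ_le_const) auto
    hence "infdist (y + z) S = 0" using infdist_nonneg[of "y+z" S] by linarith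
    hence "y + z \<in> S" using assms False in_closed_iff_infdist_zero by blast
    thus "hits S y L" using z by (auto simp: hits_def)
  qed
  have "{p \<in> space (borel \<Otimes>\<^sub>M convex_bodies). hits S (fst p) (snd p)} =
    {p \<in> space (borel \<Otimes>\<^sub>M convex_bodies). \<forall>k. \<exists>q\<in>Q. infdist (fst p + q) S < ?e k \<and> snd p \<inter> ball q (?e k) \<noteq> {}}"
    by (rule Collect_cong) (auto simp: eq space_pair_measure space_convex_bodies)
  also have "\<dots> = {p \<in> space (borel \<Otimes>\<^sub>M convex_bodies). \<forall>k. \<exists>q\<in>Q.
     p \<in> {y \<in> space borel. infdist (y + q) S < ?e k} \<times> {L \<in> space convex_bodies. L \<inter> ball q (?e k) \<noteq> {}}}"
    by (auto simp: space_pair_measure)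
  also have "\<dots> \<in> sets (borel \<Otimes>\<^sub>M convex_bodies)"
  proof (rule sets.sets_Collect_countable_All, rule sets.sets_Collect_countable_Ex'[OF _ Q(1)])
    fix q k
    have "open {y. infdist (y + q) S < ?e k}" by (intro open_Collect_less continuous_intros)
    hence "{y \<in> space borel. infdist (y + q) S < ?e k} \<in> sets borel" by simp
    moreover have "{L \<in> space convex_bodies. L \<inter> ball q (?e k) \<noteq> {}} \<in> sets convex_bodies"
      by (rule hit_open_in_sets) simp
    ultimately have "{y \<in> space borel. infdist (y + q) S < ?e k} \<times> {L \<in> space convex_bodies. L \<inter> ball q (?e k) \<noteq> {}}
        \<in> sets (borel \<Otimes>\<^sub>M convex_bodies)" (is "?R \<in> _")
      by (rule pair_measureI)
    hence "?R \<inter> space (borel \<Otimes>\<^sub>M convex_bodies) \<in> sets (borel \<Otimes>\<^sub>M convex_bodies)" by auto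
    thus "{p \<in> space (borel \<Otimes>\<^sub>M convex_bodies).
        p \<in> {y \<in> space borel. infdist (y + q) S < ?e k} \<times> {L \<in> space convex_bodies. L \<inter> ball q (?e k) \<noteq> {}}}
      \<in> sets (borel \<Otimes>\<^sub>M convex_bodies)"
      by (simp only: Collect_conj_eq Collect_mem_eq Int_commute)
  qed
  finally show ?thesis .
qed

subsection \<open>Void probabilities of marked Poisson processes\<close>

text \<open>The probability generating function of the Poisson law, obtained by splitting
  \<open>a ^ N\<close> over the level sets of \<open>N\<close> and summing the exponential
  series.\<close>

lemma poisson_power_integral:
  fixes N :: "'w \<Rightarrow> nat"
  assumes "prob_space M" and N: "N \<in> measurable M (count_space UNIV)"
    and P: "\<And>k. measure M {\<omega> \<in> space M. N \<omega> = k} = l ^ k / fact k * exp (- l)"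
    and a: "0 \<le> a" "a \<le> 1" 
  shows "(\<integral>\<omega>. a ^ N \<omega> \<partial>M) = exp (- ((1 - a) * l))"
proof -
  interpret prob_space M by fact
  define f where "f = (\<lambda>k \<omega>. a ^ k * indicator {\<omega> \<in> space M. N \<omega> = k} \<omega>)"
  have sets: "{\<omega> \<in> space M. N \<omega> = k} \<in> sets M" for k using N by measurable
  have "l \<ge> 0"
  proof (rule ccontr)
    assume "\<not> l \<ge> 0"
    moreover have "l * exp (- l) \<ge> 0"
      using P[of 1] measure_nonneg[of M "{\<omega> \<in> space M. N \<omega> = 1}"] by simp
    ultimately show False by (simp add: zero_le_mult_iff)
  qed
  have S: "(\<lambda>k. a ^ k * (l ^ k / fact k * exp (- l))) sums (exp (a * l) * exp (- l))"
    using sums_mult2[OF exp_converges[of "a * l"], of "exp (- l)"]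
    by (simp add: power_mult_distrib field_simps)
  have int: "integrable M (f k)" for k unfolding f_def
    by (intro integrable_mult_right integrable_real_indicator sets) (simp add: less_top[symmetric])
  have f: "(\<integral>\<omega>. f k \<omega> \<partial>M) = a ^ k * (l ^ k / fact k * exp (- l))" for k
    unfolding f_def using sets P[of k] by simp
  have fn: "(\<integral>\<omega>. norm (f k \<omega>) \<partial>M) = a ^ k * (l ^ k / fact k * exp (- l))" for k
    unfolding f[symmetric] using a by (intro Bochner_Integration.integral_cong) (auto simp: f_def abs_mult)
  have single: "f k \<omega> = (if k = N \<omega> then a ^ N \<omega> else 0)" if "\<omega> \<in> space M" for k \<omega>
    using that by (auto simp: f_def indicator_def)
  have "(\<integral>\<omega>. (\<Sum>k. f k \<omega>) \<partial>M) = (\<Sum>k. \<integral>\<omega>. f k \<omega> \<partial>M)"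
  proof (rule integral_suminf)
    show "AE \<omega> in M. summable (\<lambda>k. norm (f k \<omega>))"
    proof (rule AE_I2)
      fix \<omega> assume "\<omega> \<in> space M"
      show "summable (\<lambda>k. norm (f k \<omega>))"
        by (rule summable_finite[of "{N \<omega>}"]) (use \<open>\<omega> \<in> space M\<close> in \<open>auto simp: single\<close>)
    qed
    show "summable (\<lambda>k. \<integral>\<omega>. norm (f k \<omega>) \<partial>M)"
      unfolding fn using S by (rule sums_summable)
  qed (fact int)
  also have "(\<integral>\<omega>. (\<Sum>k. f k \<omega>) \<partial>M) = (\<integral>\<omega>. a ^ N \<omega> \<partial>M)"
  proof (rule Bochner_Integration.integral_cong[OF refl])
    fix \<omega> assume "\<omega> \<in> space M"
    have "(\<Sum>k. f k \<omega>) = (\<Sum>k\<in>{N \<omega>}. f k \<omega>)"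
      by (rule suminf_finite) (use \<open>\<omega> \<in> space M\<close> in \<open>auto simp: single\<close>)
    thus "(\<Sum>k. f k \<omega>) = a ^ N \<omega>" using \<open>\<omega> \<in> space M\<close> by (simp add: single)
  qed
  also have "(\<Sum>k. \<integral>\<omega>. f k \<omega> \<partial>M) = exp (a * l) * exp (- l)"
    unfolding f using S by (rule sums_unique[symmetric])
  also have "\<dots> = exp (- ((1 - a) * l))" by (simp add: exp_add[symmetric] algebra_simps)
  finally show ?thesis .
qed

text \<open>If \<open>p\<close> is the step function with value \<open>1 - a i\<close> on
  \<open>A i\<close>, the integrand is the product of \<open>1 - p\<close> over the points of
  \<open>X\<close> in these sets: this is the generating functional for step functions.\<close>

lemma poisson_prod_power_integral:
  fixes A :: "nat \<Rightarrow> 'a::euclidean_space set"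
  assumes "prob_space M" and X: "unit_poisson_process M X"
    and A: "\<And>i. A i \<in> sets borel" "\<And>i. bounded (A i)" "disjoint_family A"
    and a: "\<And>i. i \<in> I \<Longrightarrow> 0 \<le> a i" "\<And>i. i \<in> I \<Longrightarrow> a i \<le> 1" and "finite I"
  shows "(\<integral>\<omega>. (\<Prod>i\<in>I. a i ^ card (X \<omega> \<inter> A i)) \<partial>M) = exp (- (\<Sum>i\<in>I. (1 - a i) * measure lborel (A i)))"
proof -
  interpret prob_space M by fact
  let ?N = "\<lambda>i \<omega>. card (X \<omega> \<inter> A i)"
  have N: "?N i \<in> measurable M (count_space UNIV)" for i
    using X A unfolding unit_poisson_process_def by auto
  have P: "measure M {\<omega> \<in> space M. ?N i \<omega> = k}
               = measure lborel (A i) ^ k / fact k * exp (- measure lborel (A i))" for i k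
    using X A unfolding unit_poisson_process_def by auto
  have "indep_vars (\<lambda>_. count_space UNIV) ?N UNIV"
    using X A unfolding unit_poisson_process_def by auto
  hence "indep_vars (\<lambda>_. count_space UNIV) ?N I" by (rule indep_vars_subset) simp
  hence ind: "indep_vars (\<lambda>_. borel) (\<lambda>i \<omega>. a i ^ ?N i \<omega>) I"
    by (rule indep_vars_compose2) auto
  have "(\<integral>\<omega>. (\<Prod>i\<in>I. a i ^ ?N i \<omega>) \<partial>M) = (\<Prod>i\<in>I. \<integral>\<omega>. a i ^ ?N i \<omega> \<partial>M)"
  proof (rule indep_vars_lebesgue_integral[OF \<open>finite I\<close> ind])
    fix i assume "i \<in> I"
    show "integrable M (\<lambda>\<omega>. a i ^ ?N i \<omega>)"
    proof (rule integrable_const_bound[where B = 1])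
      show "(\<lambda>\<omega>. a i ^ ?N i \<omega>) \<in> borel_measurable M"
        using measurable_compose[OF N, of "\<lambda>n. a i ^ n" borel i] by simp
    qed (use a \<open>i \<in> I\<close> in \<open>auto simp: power_le_one\<close>)
  qed
  also have "\<dots> = (\<Prod>i\<in>I. exp (- ((1 - a i) * measure lborel (A i))))"
    by (intro prod.cong refl poisson_power_integral assms N P)
  also have "\<dots> = exp (- (\<Sum>i\<in>I. (1 - a i) * measure lborel (A i)))"
    using \<open>finite I\<close> by (simp add: exp_sum sum_negf[symmetric])
  finally show ?thesis .
qed


text \<open>The probability generating functional of the Poisson process, as a limit of partial
  products along the enumeration. Almost surely these become constant, since only finitely many
  points lie in \<open>B\<close>. Step functions below \<open>p\<close> have the same almost sure
  limit and known expectations, and everything is bounded by 1.\<close>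

lemma poisson_generating_functional:
  fixes p :: "'a::euclidean_space \<Rightarrow> real"
  assumes "prob_space M" and X: "unit_poisson_process M X"
    and x: "\<And>n. x n \<in> borel_measurable M" "AE \<omega> in M. bij_betw (\<lambda>n. x n \<omega>) UNIV (X \<omega>)"
    and p: "p \<in> borel_measurable borel" "\<And>y. 0 \<le> p y" "\<And>y. p y \<le> 1"
    and B: "B \<in> sets borel" "bounded B" "\<And>y. y \<notin> B \<Longrightarrow> p y = 0"
  shows "(\<lambda>k. \<integral>\<omega>. (\<Prod>n<k. 1 - p (x n \<omega>)) \<partial>M) \<longlonglongrightarrow> exp (- (\<integral>y. p y \<partial>lborel))"
proof -
  interpret prob_space M by fact
  \<comment> \<open>\<open>q k\<close> rounds \<open>p\<close> down to a multiple of
    \<open>1 / (k + 1)\<close>; its level sets in \<open>B\<close> are the \<open>A k j\<close>,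
    with \<open>j\<close> up to \<open>Suc k\<close> because \<open>p\<close> may reach 1.\<close>
  define q where "q = (\<lambda>k y. real (nat \<lfloor>real (Suc k) * p y\<rfloor>) / real (Suc k))"
  define A where "A = (\<lambda>k j. {y\<in>B. nat \<lfloor>real (Suc k) * p y\<rfloor> = j})"
  define g where "g = (\<lambda>k \<omega>. \<Prod>j\<le>Suc k. (1 - real j / real (Suc k)) ^ card (X \<omega> \<inter> A k j))"
  define F where "F = (\<lambda>k \<omega>. \<Prod>n<k. 1 - p (x n \<omega>))"
  define G where "G = (\<lambda>\<omega>. \<Prod>y\<in>X \<omega> \<inter> B. 1 - p y)"
  note [measurable] = p(1) x(1) B(1)
  have A_sets: "A k j \<in> sets borel" for k j
  proof -
    have "A k j = {y \<in> space borel. y \<in> B \<and> nat \<lfloor>real (Suc k) * p y\<rfloor> = j}" by (auto simp: A_def)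
    also have "\<dots> \<in> sets borel" by measurable
    finally show ?thesis .
  qed
  have A_bounded: "bounded (A k j)" for k j
    by (rule bounded_subset[OF B(2)]) (auto simp: A_def)
  have A_disj: "disjoint_family (A k)" for k
    by (auto simp: A_def disjoint_family_on_def)
  have q0: "0 \<le> q k y" for k y by (simp add: q_def)
  have floor_le: "nat \<lfloor>real (Suc k) * p y\<rfloor> \<le> Suc k" for k y
  proof -
    have "real (Suc k) * p y \<le> real (Suc k)" using p(3)[of y] by (simp add: mult_left_le)
    thus ?thesis by linarith
  qed
  have q1: "q k y \<le> 1" for k y
    using floor_le[of k y] by (simp add: q_def del: of_nat_Suc)
  have q_A: "q k y = real j / real (Suc k)" if "y \<in> A k j" for k j y
    using that by (auto simp: q_def A_def)
  have q_B: "q k y = 0" if "y \<notin> B" for k y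
    using that by (simp add: q_def B)
  have q_lim: "(\<lambda>k. q k y) \<longlonglongrightarrow> p y" for y
  proof (rule real_tendsto_sandwich)
    show "\<forall>\<^sub>F k in sequentially. p y - 1 / real (Suc k) \<le> q k y"
    proof (intro always_eventually allI)
      fix k
      have "real (Suc k) * p y - 1 \<le> real (nat \<lfloor>real (Suc k) * p y\<rfloor>)" by linarith
      hence "(real (Suc k) * p y - 1) / real (Suc k) \<le> q k y"
        unfolding q_def by (rule divide_right_mono) simp
      thus "p y - 1 / real (Suc k) \<le> q k y" by (simp add: diff_divide_distrib del: of_nat_Suc)
    qed
    show "\<forall>\<^sub>F k in sequentially. q k y \<le> p y"
    proof (intro always_eventually allI)
      fix k
      have "0 \<le> real (Suc k) * p y" using p(2)[of y] by simp
      hence "real (nat \<lfloor>real (Suc k) * p y\<rfloor>) \<le> real (Suc k) * p y" by linarith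
      hence "q k y \<le> real (Suc k) * p y / real (Suc k)"
        unfolding q_def by (rule divide_right_mono) simp
      thus "q k y \<le> p y" by (simp del: of_nat_Suc)
    qed
  qed (real_asymp, simp)
  have B_int: "integrable lborel (indicator B :: 'a \<Rightarrow> real)"
    using emeasure_bounded_finite[OF B(2)] by (simp add: integrable_indicator_iff)
  have q_meas [measurable]: "q k \<in> borel_measurable borel" for k
    unfolding q_def by measurable
  have q_int: "(\<lambda>k. \<integral>y. q k y \<partial>lborel) \<longlonglongrightarrow> (\<integral>y. p y \<partial>lborel)"
  proof (rule integral_dominated_convergence[where w = "indicator B"])
    show "AE y in lborel. norm (q k y) \<le> indicator B y" for k
      using q0 q1 q_B by (intro always_eventually) (auto simp: indicator_def)
  qed (use q_lim B_int in auto)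
  have q_sum: "(\<integral>y. q k y \<partial>lborel) = (\<Sum>j\<le>Suc k. (1 - (1 - real j / real (Suc k))) * measure lborel (A k j))" for k
  proof -
    have "q k y = (\<Sum>j\<le>Suc k. real j / real (Suc k) * indicator (A k j) y)" for y
    proof (cases "y \<in> B")
      case True
      let ?j = "nat \<lfloor>real (Suc k) * p y\<rfloor>"
      have "(\<Sum>j\<le>Suc k. real j / real (Suc k) * indicator (A k j) y) = (\<Sum>j\<in>{?j}. real j / real (Suc k) * indicator (A k j) y)"
        using floor_le[of k y] by (intro sum.mono_neutral_right) (auto simp: A_def indicator_def)
      thus ?thesis using True by (simp add: q_def A_def)
    next
      case False
      thus ?thesis by (simp add: q_B A_def)
    qed
    hence "(\<integral>y. q k y \<partial>lborel) = (\<integral>y. (\<Sum>j\<le>Suc k. real j / real (Suc k) * indicator (A k j) y) \<partial>lborel)"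
      by simp
    also have "\<dots> = (\<Sum>j\<le>Suc k. real j / real (Suc k) * measure lborel (A k j))"
    proof (subst Bochner_Integration.integral_sum)
      show "integrable lborel (\<lambda>y. real j / real (Suc k) * indicator (A k j) y)" for j
        using emeasure_bounded_finite[OF A_bounded[of k j]] A_sets[of k j]
        by (intro integrable_mult_right) (simp add: integrable_indicator_iff)
    qed simp
    finally show ?thesis by simp
  qed
  have g_int: "(\<integral>\<omega>. g k \<omega> \<partial>M) = exp (- (\<integral>y. q k y \<partial>lborel))" for k
    unfolding g_def q_sum
    by (rule poisson_prod_power_integral) (use assms A_sets A_bounded A_disj in auto)
  have g_meas [measurable]: "g k \<in> borel_measurable M" for k
  proof -
    have "(\<lambda>\<omega>. card (X \<omega> \<inter> A k j)) \<in> measurable M (count_space UNIV)" for j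
      using X A_sets A_bounded unfolding unit_poisson_process_def by auto
    hence "(\<lambda>\<omega>. (1 - real j / real (Suc k)) ^ card (X \<omega> \<inter> A k j)) \<in> borel_measurable M" for j
      using measurable_compose[of _ M "count_space UNIV" "\<lambda>n. (1 - real j / real (Suc k)) ^ n" borel] by simp
    thus ?thesis unfolding g_def by measurable
  qed
  have F_meas [measurable]: "F k \<in> borel_measurable M" for k
    unfolding F_def by measurable
  \<comment> \<open>\<open>G\<close> depends on the random set \<open>X\<close> itself, for which
    only counts are known to be measurable; the limit of the \<open>F k\<close> is a measurable
    function that equals it almost surely.\<close>
  define F' where "F' = (\<lambda>\<omega>. lim (\<lambda>k. F k \<omega>))"
  have F'_meas [measurable]: "F' \<in> borel_measurable M"
    unfolding F'_def by (rule borel_measurable_lim_metric) measurable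
  have "AE \<omega> in M. \<forall>B. bounded B \<longrightarrow> finite (X \<omega> \<inter> B)"
    using X by (simp add: unit_poisson_process_def)
  with x(2) have lims: "AE \<omega> in M. (\<lambda>k. F k \<omega>) \<longlonglongrightarrow> F' \<omega> \<and> (\<lambda>k. g k \<omega>) \<longlonglongrightarrow> F' \<omega>"
  proof eventually_elim
    case (elim \<omega>)
    have fin: "finite (X \<omega> \<inter> B)" using elim B by blast
    have "g k \<omega> = (\<Prod>y\<in>X \<omega> \<inter> B. 1 - q k y)" for k
    proof -
      have "X \<omega> \<inter> B = (\<Union>j\<in>{..Suc k}. X \<omega> \<inter> A k j)" using floor_le by (auto simp: A_def)
      moreover have "(\<Prod>y\<in>(\<Union>j\<in>{..Suc k}. X \<omega> \<inter> A k j). 1 - q k y) = (\<Prod>j\<le>Suc k. \<Prod>y\<in>X \<omega> \<inter> A k j. 1 - q k y)"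
      proof (rule prod.UNION_disjoint)
        show "\<forall>j\<in>{..Suc k}. finite (X \<omega> \<inter> A k j)" using elim(2) A_bounded by blast
      qed (auto simp: A_def)
      moreover have "(\<Prod>y\<in>X \<omega> \<inter> A k j. 1 - q k y) = (1 - real j / real (Suc k)) ^ card (X \<omega> \<inter> A k j)" for j
        unfolding prod_constant[symmetric] by (rule prod.cong) (use q_A in auto)
      ultimately show ?thesis by (simp add: g_def)
    qed
    hence gl: "(\<lambda>k. g k \<omega>) \<longlonglongrightarrow> G \<omega>"
      unfolding G_def by (simp, intro tendsto_intros q_lim)
    define J where "J = {n. x n \<omega> \<in> B}"
    have inj: "inj_on (\<lambda>n. x n \<omega>) J" using elim(1) by (auto simp: bij_betw_def inj_on_def)
    have img: "(\<lambda>n. x n \<omega>) ` J = X \<omega> \<inter> B" using elim(1) by (auto simp: bij_betw_def J_def)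
    have "finite J" using inj img fin finite_image_iff by metis
    then obtain K where K: "J \<subseteq> {..<K}" using finite_nat_bounded by blast
    \<comment> \<open>Past \<open>K\<close> all points lie outside \<open>B\<close>, where
      \<open>p\<close> is 0, so the remaining factors are 1.\<close>
    have "F k \<omega> = G \<omega>" if "k \<ge> K" for k
    proof -
      have "F k \<omega> = (\<Prod>n\<in>J. 1 - p (x n \<omega>))" unfolding F_def
        by (rule prod.mono_neutral_right) (use K that in \<open>auto simp: J_def B\<close>)
      also have "\<dots> = G \<omega>" unfolding G_def img[symmetric] by (simp add: prod.reindex[OF inj])
      finally show ?thesis .
    qed
    hence Fl: "(\<lambda>k. F k \<omega>) \<longlonglongrightarrow> G \<omega>"
      by (intro tendsto_eventually) (auto simp: eventually_sequentially)
    hence "F' \<omega> = G \<omega>" unfolding F'_def by (rule limI)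
    thus ?case using gl Fl by simp
  qed
  have F_bd: "\<bar>F k \<omega>\<bar> \<le> 1" for k \<omega>
    unfolding F_def abs_prod by (rule prod_le_1) (use p(2,3) in \<open>auto simp: abs_le_iff\<close>)
  have g_bd: "\<bar>g k \<omega>\<bar> \<le> 1" for k \<omega>
    unfolding g_def abs_prod 
    by (rule prod_le_1) (auto simp: power_abs intro!: power_le_one)
  have "(\<lambda>k. \<integral>\<omega>. F k \<omega> \<partial>M) \<longlonglongrightarrow> (\<integral>\<omega>. F' \<omega> \<partial>M)"
    by (rule integral_dominated_convergence[where w = "\<lambda>_. 1"]) (use lims F_bd in auto)
  moreover have "(\<lambda>k. \<integral>\<omega>. g k \<omega> \<partial>M) \<longlonglongrightarrow> (\<integral>\<omega>. F' \<omega> \<partial>M)"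
    by (rule integral_dominated_convergence[where w = "\<lambda>_. 1"]) (use lims g_bd in auto)
  moreover have "(\<lambda>k. \<integral>\<omega>. g k \<omega> \<partial>M) \<longlonglongrightarrow> exp (- (\<integral>y. p y \<partial>lborel))"
    unfolding g_int by (intro tendsto_intros q_int)
  ultimately show ?thesis unfolding F_def using LIMSEQ_unique by metis
qed

text \<open>The marking theorem: given the positions, the independent grains keep a point at
  \<open>y\<close> out of \<open>H\<close> with probability \<open>1 - p y\<close>, where
  \<open>p y\<close> is the \<open>Q\<close>-measure of the section of \<open>H\<close> at
  \<open>y\<close>; the generating functional then averages over the positions.\<close>

lemma void_probability:
  fixes H :: "('a::euclidean_space \<times> 'a set) set"
  assumes "prob_space M" and X: "unit_poisson_process M X" and G: "iid_grains M X Q x Z"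
    and H: "H \<in> sets (borel \<Otimes>\<^sub>M convex_bodies)"
    and B: "B \<in> sets borel" "bounded B" "\<And>y. y \<notin> B \<Longrightarrow> measure Q (Pair y -` H) = 0"
  shows "{\<omega> \<in> space M. \<forall>n. (x n \<omega>, Z n \<omega>) \<notin> H} \<in> sets M"
    and "measure M {\<omega> \<in> space M. \<forall>n. (x n \<omega>, Z n \<omega>) \<notin> H}
       = exp (- (\<integral>y. measure Q (Pair y -` H) \<partial>lborel))"
proof -
  interpret prob_space M by fact
  have x [measurable]: "\<And>n. x n \<in> borel_measurable M"
    and bij: "AE \<omega> in M. bij_betw (\<lambda>n. x n \<omega>) UNIV (X \<omega>)"
    and Z [measurable]: "\<And>n. Z n \<in> measurable M convex_bodies" 
    and ZQ: "\<And>n. distr M convex_bodies (Z n) = Q"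
    and indZ: "indep_vars (\<lambda>_. convex_bodies) Z UNIV"
    and ind: "indep_set (sets (vimage_algebra (space M) (\<lambda>\<omega> n. x n \<omega>) (Pi\<^sub>M UNIV (\<lambda>_. borel))))
       (sets (vimage_algebra (space M) (\<lambda>\<omega> n. Z n \<omega>) (Pi\<^sub>M UNIV (\<lambda>_. convex_bodies))))"
    using G unfolding iid_grains_def by auto
  note [measurable] = H
  have Q: "prob_space Q" unfolding ZQ[of 0, symmetric] by (rule prob_space_distr) simp
  interpret Q: prob_space Q by (fact Q)
  have sQ [measurable_cong]: "sets Q = sets convex_bodies" unfolding ZQ[of 0, symmetric] by simp
  let ?x = "\<lambda>\<omega> n. x n \<omega>" and ?Z = "\<lambda>\<omega> n. Z n \<omega>"
  let ?Bx = "Pi\<^sub>M UNIV (\<lambda>_::nat. borel :: 'a measure)" 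
  let ?BZ = "Pi\<^sub>M UNIV (\<lambda>_::nat. convex_bodies :: 'a set measure)"
  let ?Px = "distr M ?Bx ?x" and ?PZ = "Pi\<^sub>M UNIV (\<lambda>_::nat. Q)"
  have mx [measurable]: "?x \<in> measurable M ?Bx" by (rule measurable_PiM_single') auto
  have mZ [measurable]: "?Z \<in> measurable M ?BZ" 
    by (rule measurable_PiM_single') (auto simp: measurable_space[OF Z])
  have PZ: "distr M ?BZ ?Z = ?PZ"
    using indep_vars_iff_distr_eq_PiM[where I = UNIV and M' = "\<lambda>_. convex_bodies" and X = Z] indZ Z ZQ by (simp add: restrict_def)
  interpret Px: prob_space ?Px by (rule prob_space_distr) simp
  interpret PZ: prob_space ?PZ by (rule prob_space_PiM) (rule Q)
  \<comment> \<open>Independence is given for the generated sigma-algebras. It is turned into a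
    product form of the joint law of the two sequences, checked on rectangles, so that the positions
    can be frozen.\<close>
  have joint: "?Px \<Otimes>\<^sub>M ?PZ = distr M (?Bx \<Otimes>\<^sub>M ?BZ) (\<lambda>\<omega>. (?x \<omega>, ?Z \<omega>))"
  proof (rule pair_measure_eqI)
    show "sigma_finite_measure ?Px" "sigma_finite_measure ?PZ" by unfold_locales
    show "sets (?Px \<Otimes>\<^sub>M ?PZ) = sets (distr M (?Bx \<Otimes>\<^sub>M ?BZ) (\<lambda>\<omega>. (?x \<omega>, ?Z \<omega>)))"
      unfolding PZ[symmetric] by simp
    fix S T assume S: "S \<in> sets ?Px" and T: "T \<in> sets ?PZ"
    have S' [measurable]: "S \<in> sets ?Bx" using S by simp
    have T' [measurable]: "T \<in> sets ?BZ" using T unfolding PZ[symmetric] by simp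
    have "prob ((?x -` S \<inter> space M) \<inter> (?Z -` T \<inter> space M)) = prob (?x -` S \<inter> space M) * prob (?Z -` T \<inter> space M)"
      by (rule indep_setD[OF ind]) (auto intro!: in_vimage_algebra)
    moreover have "(\<lambda>\<omega>. (?x \<omega>, ?Z \<omega>)) -` (S \<times> T) \<inter> space M = (?x -` S \<inter> space M) \<inter> (?Z -` T \<inter> space M)"
      by auto
    ultimately show "emeasure ?Px S * emeasure ?PZ T = emeasure (distr M (?Bx \<Otimes>\<^sub>M ?BZ) (\<lambda>\<omega>. (?x \<omega>, ?Z \<omega>))) (S \<times> T)"
      unfolding PZ[symmetric] by (simp add: emeasure_distr emeasure_eq_measure ennreal_mult)
  qed
  define p where "p = (\<lambda>y. measure Q (Pair y -` H))"
  have sec: "Pair y -` H \<in> sets Q" for y using sets_Pair1[OF H] sQ by simp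
  have p: "p \<in> borel_measurable borel" "0 \<le> p y" "p y \<le> 1" for y
  proof -
    have "(\<lambda>y. measure Q (Pair y -` H)) \<in> borel_measurable borel"
      unfolding measure_def
      by (intro borel_measurable_enn2real Q.measurable_emeasure_Pair) (use H in measurable)
    thus "p \<in> borel_measurable borel" by (simp add: p_def)
  qed (auto simp: p_def)
  \<comment> \<open>Restricting to the first \<open>k\<close> points makes each section a cylinder
    set of the product measure; continuity from above recovers the whole sequence.\<close>
  let ?E = "\<lambda>k. {\<omega> \<in> space M. \<forall>n<k. (x n \<omega>, Z n \<omega>) \<notin> H}"
  have E: "?E k \<in> sets M" for k by measurable
  show "{\<omega> \<in> space M. \<forall>n. (x n \<omega>, Z n \<omega>) \<notin> H} \<in> sets M" by measurable
  have *: "measure M (?E k) = (\<integral>\<omega>. (\<Prod>n<k. 1 - p (x n \<omega>)) \<partial>M)" for k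
  proof -
    let ?S = "{f \<in> space (?Bx \<Otimes>\<^sub>M ?BZ). \<forall>n<k. (fst f n, snd f n) \<notin> H}"
    have S: "?S \<in> sets (?Bx \<Otimes>\<^sub>M ?BZ)" by measurable
    have "emeasure M (?E k) = emeasure (distr M (?Bx \<Otimes>\<^sub>M ?BZ) (\<lambda>\<omega>. (?x \<omega>, ?Z \<omega>))) ?S"
      using S measurable_space[OF mx] measurable_space[OF mZ]
      by (subst emeasure_distr) (auto simp: space_pair_measure intro!: arg_cong[where f = "emeasure M"])
    also have "\<dots> = emeasure (?Px \<Otimes>\<^sub>M ?PZ) ?S" by (simp only: joint)
    also have "\<dots> = (\<integral>\<^sup>+ f. emeasure ?PZ (Pair f -` ?S) \<partial>?Px)"
      by (rule PZ.emeasure_pair_measure_alt) (use S in \<open>simp add: PZ[symmetric]\<close>)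
    also have "\<dots> = (\<integral>\<^sup>+ f. ennreal (\<Prod>n<k. 1 - p (f n)) \<partial>?Px)"
    proof (rule nn_integral_cong)
      fix f assume "f \<in> space ?Px"
      have "Pair f -` ?S = prod_emb UNIV (\<lambda>_. Q) {..<k} (Pi\<^sub>E {..<k} (\<lambda>n. space Q - Pair (f n) -` H))"
        using sets_eq_imp_space_eq[OF sQ] 
        by (auto simp: prod_emb_def space_pair_measure space_PiM PiE_iff extensional_def)
      also have "emeasure ?PZ \<dots> = (\<Prod>n<k. emeasure Q (space Q - Pair (f n) -` H))"
        by (rule emeasure_PiM_emb) (use Q sec in auto)
      also have "\<dots> = (\<Prod>n<k. ennreal (1 - p (f n)))"
        unfolding p_def by (intro prod.cong refl) (simp add: Q.emeasure_eq_measure Q.prob_compl sec)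
      also have "\<dots> = ennreal (\<Prod>n<k. 1 - p (f n))"
        by (rule prod_ennreal) (use p in auto)
      finally show "emeasure ?PZ (Pair f -` ?S) = ennreal (\<Prod>n<k. 1 - p (f n))" .
    qed
    also have "\<dots> = (\<integral>\<^sup>+ \<omega>. ennreal (\<Prod>n<k. 1 - p (x n \<omega>)) \<partial>M)"
      using p(1) by (subst nn_integral_distr) auto
    also have "\<dots> = ennreal (\<integral>\<omega>. (\<Prod>n<k. 1 - p (x n \<omega>)) \<partial>M)"
    proof (rule nn_integral_eq_integral)
      show "integrable M (\<lambda>\<omega>. \<Prod>n<k. 1 - p (x n \<omega>))"
      proof (rule integrable_const_bound[where B = 1])
        show "AE \<omega> in M. norm (\<Prod>n<k. 1 - p (x n \<omega>)) \<le> 1"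
          unfolding real_norm_def abs_prod by (intro always_eventually allI prod_le_1) (use p(2,3) in \<open>auto simp: abs_le_iff\<close>)
        show "(\<lambda>\<omega>. \<Prod>n<k. 1 - p (x n \<omega>)) \<in> borel_measurable M" using p(1) by measurable
      qed
    qed (use p in \<open>auto intro!: prod_nonneg\<close>)
    finally have "ennreal (measure M (?E k)) = ennreal (\<integral>\<omega>. (\<Prod>n<k. 1 - p (x n \<omega>)) \<partial>M)"
      by (simp add: emeasure_eq_measure)
    moreover have "0 \<le> (\<integral>\<omega>. (\<Prod>n<k. 1 - p (x n \<omega>)) \<partial>M)"
      by (intro Bochner_Integration.integral_nonneg prod_nonneg) (use p in auto)
    ultimately show ?thesis by simp
  qed
  have "(\<lambda>k. measure M (?E k)) \<longlonglongrightarrow> exp (- (\<integral>y. p y \<partial>lborel))"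
    unfolding * by (rule poisson_generating_functional) (use assms x bij p B in \<open>auto simp: p_def\<close>)
  moreover have "(\<lambda>k. measure M (?E k)) \<longlonglongrightarrow> measure M (\<Inter>k. ?E k)"
    by (rule finite_Lim_measure_decseq) (use E in \<open>auto simp: decseq_def\<close>)
  moreover have "(\<Inter>k. ?E k) = {\<omega> \<in> space M. \<forall>n. (x n \<omega>, Z n \<omega>) \<notin> H}"
    by auto
  ultimately show "measure M {\<omega> \<in> space M. \<forall>n. (x n \<omega>, Z n \<omega>) \<notin> H}
       = exp (- (\<integral>y. measure Q (Pair y -` H) \<partial>lborel))"
    unfolding p_def by (metis (no_types, lifting) LIMSEQ_unique)
qed

subsection \<open>Segments and convex bodies in the plane\<close>

definition dirv :: "real \<Rightarrow> real^2" where "dirv t = vector [cos t, sin t]"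
text \<open>A closed segment, empty for negative \<open>s\<close>. For \<open>s \<ge> 0\<close> it
  contains the origin, which \<open>visibility\<close> leaves out, so a free \<open>ray\<close>
  includes the conditioning event.\<close>

definition ray :: "real \<Rightarrow> real \<Rightarrow> (real^2) set" where "ray s t = (\<lambda>z. z *\<^sub>R dirv t) ` {0..s}"
definition rot :: "real \<Rightarrow> real^2^2" where
  "rot t = vector [vector [cos t, - sin t], vector [sin t, cos t]]"

lemma dirv_nth [simp]: "dirv t $ 1 = cos t" "dirv t $ 2 = sin t"
  by (simp_all add: dirv_def)

lemma norm_dirv [simp]: "norm (dirv t) = 1"
  by (simp add: norm_vec_def L2_set_def sum_2)

lemma rot_mult_nth [simp]:
  "(rot t *v y) $ 1 = cos t * y $ 1 - sin t * y $ 2" "(rot t *v y) $ 2 = sin t * y $ 1 + cos t * y $ 2"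
  by (simp_all add: matrix_vector_mult_def sum_2 rot_def)

lemma vec2_eqI: "v $ 1 = w $ 1 \<Longrightarrow> v $ 2 = w $ 2 \<Longrightarrow> v = (w :: 'b^2)"
  by (simp add: vec_eq_iff forall_2)

lemma rot_dirv: "rot t *v dirv a = dirv (t + a)"
  by (rule vec2_eqI) (simp_all add: cos_add sin_add)

lemma rot_inverse: "rot t *v (rot (- t) *v y) = y" "rot (- t) *v (rot t *v y) = y"
proof -
  have *: "cos t * (cos t * a) + sin t * (sin t * a) = a" for a
    using arg_cong[OF sin_cos_squared_add3[of t], of "\<lambda>c. c * a"] by (simp only: distrib_right mult.assoc mult_1)
  show "rot t *v (rot (- t) *v y) = y" "rot (- t) *v (rot t *v y) = y"
    by (rule vec2_eqI; simp add: algebra_simps *)+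
qed

lemma rotation_matrix_rot: "rotation_matrix (rot t)"
proof -
  have "rot t ** transpose (rot t) = mat 1" "transpose (rot t) ** rot t = mat 1"
    by (simp_all add: matrix_matrix_mult_def transpose_def mat_def vec_eq_iff forall_2 sum_2 rot_def
        power2_eq_square[symmetric])
  moreover have "det (rot t) = 1"
    by (simp add: det_2 rot_def power2_eq_square[symmetric])
  ultimately show ?thesis by (simp add: rotation_matrix_def orthogonal_matrix_def)
qed

lemma orthogonal_rot: "orthogonal_transformation ((*v) (rot t))"
  using rotation_matrix_rot[of t] unfolding rotation_matrix_def
  by (simp add: orthogonal_transformation_matrix)

lemma norm_rot: "norm (rot t *v y) = norm y"
  using orthogonal_rot orthogonal_transformation_norm by blast

lemma ray_rot: "ray s (t + a) = (*v) (rot t) ` ray s a"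
  by (simp add: ray_def image_image rot_dirv[symmetric] matrix_vector_mult_scaleR)

lemma hits_rot: "hits ((*v) (rot t) ` S) y ((*v) (rot t) ` L) \<longleftrightarrow> hits S (rot (- t) *v y) L"
proof -
  have "y + rot t *v z \<in> (*v) (rot t) ` S \<longleftrightarrow> rot (- t) *v y + z \<in> S" for z
  proof -
    have "y + rot t *v z = rot t *v (rot (- t) *v y + z)"
      by (simp add: matrix_vector_right_distrib rot_inverse)
    moreover have "inj ((*v) (rot t))" by (metis injI rot_inverse(2))
    ultimately show ?thesis by (simp add: inj_image_mem_iff)
  qed
  thus ?thesis by (auto simp: hits_def)
qed

lemma measurable_rot [measurable]: "(*v) (rot t) \<in> borel_measurable borel"
  by (intro borel_measurable_continuous_onI matrix_vector_mult_linear_continuous_on)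

text \<open>Values on boxes determine \<open>lborel\<close>. The preimage of a box is its image
  under the inverse rotation, whose volume is that of the box by orthogonality; the volume of the
  image is computed in \<open>lebesgue\<close>, which agrees with \<open>lborel\<close> on Borel
  sets.\<close>

lemma distr_lborel_rot: "distr lborel borel ((*v) (rot t)) = lborel"
proof (rule lborel_eqI[symmetric])
  fix l u :: "real^2" assume lu: "\<And>b. b \<in> Basis \<Longrightarrow> l \<bullet> b \<le> u \<bullet> b"
  have eq: "(*v) (rot t) -` box l u \<inter> space lborel = (*v) (rot (- t)) ` box l u"
    by (auto simp: rot_inverse intro!: image_eqI[where x = "rot t *v _"])
  have "(*v) (rot (- t)) ` box l u \<in> lmeasurable"
    by (rule measurable_orthogonal_image[OF orthogonal_rot]) simp
  hence fin: "emeasure lebesgue ((*v) (rot (- t)) ` box l u) = ennreal (measure lebesgue ((*v) (rot (- t)) ` box l u))"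
    by (rule emeasure_eq_measure2)
  have sets: "(*v) (rot (- t)) ` box l u \<in> sets borel"
    unfolding eq[symmetric] using measurable_sets[OF measurable_rot[of t], of "box l u"] by simp
  have "emeasure (distr lborel borel ((*v) (rot t))) (box l u) = emeasure lborel ((*v) (rot (- t)) ` box l u)"
    using measurable_rot[of t] by (subst emeasure_distr) (auto simp: eq[simplified])
  also have "\<dots> = emeasure lebesgue ((*v) (rot (- t)) ` box l u)"
    using sets by simp
  also have "\<dots> = ennreal (measure lebesgue (box l u))"
    unfolding fin by (subst measure_orthogonal_image[OF orthogonal_rot]) auto
  also have "\<dots> = (\<Prod>b\<in>Basis. (u - l) \<bullet> b)"
    using lu emeasure_lborel_box_finite[of l u]
    by (simp add: measure_completion emeasure_eq_ennreal_measure[symmetric] less_top)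
  finally show "emeasure (distr lborel borel ((*v) (rot t))) (box l u) = (\<Prod>b\<in>Basis. (u - l) \<bullet> b)" .
qed simp

lemma convex_body_rot: "convex_body L \<Longrightarrow> convex_body ((*v) (rot t) ` L)"
  unfolding convex_body_def
  by (auto intro!: compact_continuous_image matrix_vector_mult_linear_continuous_on convex_linear_image)

lemma measurable_image_rot:
  assumes "K \<in> measurable N convex_bodies"
  shows "(\<lambda>\<omega>. (*v) (rot t) ` K \<omega>) \<in> measurable N convex_bodies"
proof (rule measurable_convex_bodiesI)
  show "convex_body ((*v) (rot t) ` K \<omega>)" if "\<omega> \<in> space N" for \<omega>
    using measurable_space[OF assms that] by (auto simp: space_convex_bodies intro: convex_body_rot)
  fix G :: "(real^2) set" assume "open G"
  hence "open ((*v) (rot t) -` G)"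
    by (intro open_vimage matrix_vector_mult_linear_continuous_on)
  from measurable_sets[OF assms hit_open_in_sets[OF this]]
  show "{\<omega> \<in> space N. (*v) (rot t) ` K \<omega> \<inter> G \<noteq> {}} \<in> sets N"
    by (rule back_subst[where P = "\<lambda>A. A \<in> sets N"]) (use measurable_space[OF assms] in auto)
qed

lemma perp_eq_rot: "perp = (*v) (rot (pi / 2))"
  by (intro ext vec2_eqI) (simp_all add: perp_def)

lemma inner_perp_dirv: "y \<bullet> perp (dirv t) = cos t * y $ 2 - sin t * y $ 1"
  by (simp add: perp_def inner_vec_def sum_2)

lemma width_orth_rot: "width_orth (dirv t) ((*v) (rot t) ` L) = width_orth (dirv 0) L"
proof -
  have "(rot t *v y - rot t *v x) \<bullet> perp (dirv t) = (y - x) \<bullet> perp (dirv 0)" for x y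
  proof -
    have "(rot t *v y - rot t *v x) \<bullet> perp (dirv t) = ((cos t)\<^sup>2 + (sin t)\<^sup>2) * (y $ 2 - x $ 2)"
      unfolding inner_perp_dirv by (simp add: algebra_simps power2_eq_square del: sin_cos_squared_add sin_cos_squared_add2 sin_cos_squared_add3)
    thus ?thesis by (simp add: inner_perp_dirv)
  qed
  hence "{(y - x) \<bullet> perp (dirv t) |x y. x \<in> (*v) (rot t) ` L \<and> y \<in> (*v) (rot t) ` L}
     = {(y - x) \<bullet> perp (dirv 0) |x y. x \<in> L \<and> y \<in> L}"
    by (auto simp: image_iff) metis+
  thus ?thesis by (simp add: width_orth_def)
qed

text \<open>Across \<open>dirv 0\<close> the width is the vertical extent, and compactness provides
  a lowest point \<open>p\<close> and a highest point \<open>q\<close>. The chord from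
  \<open>p\<close> to \<open>q\<close> is the part of the grain that produces the crossings in the
  lower bound on areas.\<close>

lemma width_orth_attained:
  assumes "convex_body L"
  obtains p q where "p \<in> L" "q \<in> L" "\<And>z. z \<in> L \<Longrightarrow> p $ 2 \<le> z $ 2" "\<And>z. z \<in> L \<Longrightarrow> z $ 2 \<le> q $ 2"
    "width_orth (dirv 0) L = q $ 2 - p $ 2"
proof -
  have L: "compact L" "L \<noteq> {}" using assms by (auto simp: convex_body_def)
  have c: "continuous_on L (\<lambda>z. z $ 2)" by (intro continuous_intros)
  obtain p where p: "p \<in> L" "\<And>z. z \<in> L \<Longrightarrow> p $ 2 \<le> z $ 2"
    using continuous_attains_inf[OF L c] by blast
  obtain q where q: "q \<in> L" "\<And>z. z \<in> L \<Longrightarrow> z $ 2 \<le> q $ 2"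
    using continuous_attains_sup[OF L c] by blast
  have "width_orth (dirv 0) L = q $ 2 - p $ 2"
    unfolding width_orth_def inner_perp_dirv
  proof (rule cSup_eq_maximum)
    show "q $ 2 - p $ 2 \<in> {cos 0 * (y - x) $ 2 - sin 0 * (y - x) $ 1 |x y. x \<in> L \<and> y \<in> L}"
      using p q by force
    fix a assume "a \<in> {cos 0 * (y - x) $ 2 - sin 0 * (y - x) $ 1 |x y. x \<in> L \<and> y \<in> L}"
    then obtain x y where "a = y $ 2 - x $ 2" "x \<in> L" "y \<in> L" by auto
    thus "a \<le> q $ 2 - p $ 2" using p(2)[of x] q(2)[of y] by linarith
  qed
  with p q that show ?thesis by blast
qed

section \<open>Areas of the sets of positions at which a grain hits segments\<close>

lemma mem_cbox_vec2: "y \<in> cbox (vector [a, b]) (vector [c, d] :: real^2) \<longleftrightarrow> a \<le> y $ 1 \<and> y $ 1 \<le> c \<and> b \<le> y $ 2 \<and> y $ 2 \<le> d"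
  by (auto simp: mem_box_cart forall_2)

lemma emeasure_cbox_vec2:
  "emeasure lborel (cbox (vector [a, b]) (vector [c, d] :: real^2)) = (if a \<le> c \<and> b \<le> d then ennreal ((c - a) * (d - b)) else 0)"
proof (cases "a \<le> c \<and> b \<le> d")
  case True
  hence "vector [(a + c) / 2, (b + d) / 2] \<in> cbox (vector [a, b]) (vector [c, d] :: real^2)"
    unfolding mem_cbox_vec2 by simp
  hence "measure lborel (cbox (vector [a, b]) (vector [c, d] :: real^2)) = (c - a) * (d - b)"
    by (subst content_cbox_cart) (auto simp: UNIV_2)
  moreover have "emeasure lborel (cbox (vector [a, b]) (vector [c, d] :: real^2)) \<noteq> top"
    using emeasure_lborel_cbox_finite[of "vector [a, b] :: real^2" "vector [c, d]"] by (simp add: less_top)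
  ultimately show ?thesis using True by (simp add: emeasure_eq_ennreal_measure)
next
  case False
  hence "cbox (vector [a, b]) (vector [c, d] :: real^2) = {}"
    using mem_cbox_vec2[of _ a b c d] by (fastforce simp: set_eq_iff)
  thus ?thesis unfolding if_not_P[OF False] by simp
qed

text \<open>If \<open>y + z\<close> is the point at abscissa \<open>u\<close> of the horizontal
  segment, then \<open>y $ 1 = u - z $ 1\<close> lies within \<open>D\<close> of
  \<open>{0..r}\<close>, and \<open>y $ 2 = - z $ 2\<close> lies between the negatives of the
  extreme heights of \<open>L\<close>. The resulting box has area \<open>r + 2 * D\<close> times the
  width.\<close>

lemma hits_ray_subset_cbox:
  assumes L: "convex_body L" "L \<subseteq> cball 0 D" and r: "0 \<le> r"
  shows "emeasure lborel {y. hits (ray r 0) y L} \<le> ennreal ((r + 2 * D) * width_orth (dirv 0) L)"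
proof -
  obtain p q where pq: "p \<in> L" "q \<in> L" "\<And>z. z \<in> L \<Longrightarrow> p $ 2 \<le> z $ 2" "\<And>z. z \<in> L \<Longrightarrow> z $ 2 \<le> q $ 2"
    "width_orth (dirv 0) L = q $ 2 - p $ 2"
    using width_orth_attained[OF L(1)] by blast
  let ?C = "cbox (vector [- D, - q $ 2]) (vector [r + D, - p $ 2] :: real^2)"
  have "{y. hits (ray r 0) y L} \<subseteq> ?C"
  proof
    fix y assume "y \<in> {y. hits (ray r 0) y L}"
    then obtain z u where z: "z \<in> L" "y + z = u *\<^sub>R dirv 0" "0 \<le> u" "u \<le> r"
      by (auto simp: hits_def ray_def)
    have "y $ 1 + z $ 1 = u" "y $ 2 + z $ 2 = 0"
      using arg_cong[OF z(2), of "\<lambda>w. w $ 1"] arg_cong[OF z(2), of "\<lambda>w. w $ 2"] by simp_all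
    moreover have "\<bar>z $ 1\<bar> \<le> D"
      using component_le_norm_cart[of z 1] L(2) z(1) by fastforce
    ultimately show "y \<in> ?C"
      unfolding mem_cbox_vec2 using z pq(3)[OF z(1)] pq(4)[OF z(1)] by auto
  qed
  hence "emeasure lborel {y. hits (ray r 0) y L} \<le> emeasure lborel ?C"
    by (rule emeasure_mono) simp
  also have "\<dots> \<le> ennreal ((r + 2 * D) * width_orth (dirv 0) L)"
    unfolding emeasure_cbox_vec2 pq(5) by (auto simp: algebra_simps intro!: ennreal_leI)
  finally show ?thesis .
qed

text \<open>If \<open>y\<close> lies in the box below, then \<open>y + L\<close> stays over the common horizontal extent of the two
  segments and reaches from below the first one to above the second one.\<close>

lemma hits_two_rays_lower_bound:
  assumes L: "convex_body L" "L \<subseteq> cball 0 D" and s: "0 \<le> s" "2 * D \<le> s * cos t" and t: "0 \<le> t" "t < pi / 2"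
    and sets: "{y. hits (ray s 0) y L \<and> hits (ray s t) y L} \<in> sets borel"
  shows "ennreal ((s * cos t - 2 * D) * (width_orth (dirv 0) L - s * sin t))
     \<le> emeasure lborel {y. hits (ray s 0) y L \<and> hits (ray s t) y L}"
proof -
  have conv: "convex L" using L by (simp add: convex_body_def)
  have ct: "cos t > 0" using t by (intro cos_gt_zero_pi) auto
  have st: "sin t \<ge> 0" using t by (intro sin_ge_zero) auto
  obtain p q where pq: "p \<in> L" "q \<in> L" "\<And>z. z \<in> L \<Longrightarrow> p $ 2 \<le> z $ 2" "\<And>z. z \<in> L \<Longrightarrow> z $ 2 \<le> q $ 2"
    "width_orth (dirv 0) L = q $ 2 - p $ 2"
    using width_orth_attained[OF L(1)] by blast
  \<comment> \<open>The margin \<open>D\<close> on each side keeps the abscissae of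
    \<open>y + L\<close> in \<open>{0..s * cos t}\<close>. The vertical bounds put
    \<open>y + p\<close> at height at most 0 and \<open>y + q\<close> at height at least
    \<open>s * sin t\<close>, the height of the far end of the second segment.\<close>
  let ?C = "cbox (vector [D, s * sin t - q $ 2]) (vector [s * cos t - D, - p $ 2] :: real^2)"
  have p1: "\<bar>p $ 1\<bar> \<le> D" and q1: "\<bar>q $ 1\<bar> \<le> D"
    using component_le_norm_cart[of p 1] component_le_norm_cart[of q 1] L(2) pq(1,2) by fastforce+
  have sub: "?C \<subseteq> {y. hits (ray s 0) y L \<and> hits (ray s t) y L}"
  proof
    fix y assume "y \<in> ?C"
    hence y: "D \<le> y $ 1" "y $ 1 \<le> s * cos t - D" "s * sin t - q $ 2 \<le> y $ 2" "y $ 2 \<le> - p $ 2"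
      unfolding mem_cbox_vec2 by auto
    define w where "w = (\<lambda>l::real. y + ((1 - l) *\<^sub>R p + l *\<^sub>R q))"
    have wL: "(1 - l) *\<^sub>R p + l *\<^sub>R q \<in> L" if "0 \<le> l" "l \<le> 1" for l
      using convexD_alt[OF conv pq(1,2) that] .
    have w1: "0 \<le> w l $ 1" "w l $ 1 \<le> s * cos t" if "0 \<le> l" "l \<le> 1" for l
    proof -
      have "\<bar>((1 - l) *\<^sub>R p + l *\<^sub>R q) $ 1\<bar> \<le> D"
        using component_le_norm_cart[of "(1 - l) *\<^sub>R p + l *\<^sub>R q" 1] L(2) wL[OF that] by fastforce
      thus "0 \<le> w l $ 1" "w l $ 1 \<le> s * cos t" using y by (auto simp: w_def)
    qed
    \<comment> \<open>Intermediate values along the chord \<open>w\<close>: \<open>a = 1\<close>,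
      \<open>b = 0\<close> give the line of the first segment, \<open>a = cos t\<close>,
      \<open>b = sin t\<close> that of the second.\<close>
    have cross: "\<exists>l. 0 \<le> l \<and> l \<le> 1 \<and> a * w l $ 2 = b * w l $ 1"
      if "a * w 0 $ 2 \<le> b * w 0 $ 1" "a * w 1 $ 2 \<ge> b * w 1 $ 1" for a b
    proof -
      have "\<exists>l\<ge>0. l \<le> 1 \<and> a * w l $ 2 - b * w l $ 1 = 0"
        by (rule IVT') (use that in \<open>auto simp: w_def intro!: continuous_intros\<close>)
      thus ?thesis by auto
    qed
    have scs: "s * cos t \<le> s" using s by (simp add: mult_left_le)
    have h0: "s * sin t \<ge> 0" using s st by simp
    have "\<exists>l. 0 \<le> l \<and> l \<le> 1 \<and> 1 * w l $ 2 = 0 * w l $ 1"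
      by (rule cross) (use y h0 in \<open>auto simp: w_def\<close>)
    then obtain l where l: "0 \<le> l" "l \<le> 1" "w l $ 2 = 0" by auto
    have "w l = (w l $ 1) *\<^sub>R dirv 0" by (rule vec2_eqI) (use l in auto)
    hence "w l \<in> ray s 0" unfolding ray_def using w1[OF l(1,2)] scs by (intro image_eqI) auto
    hence 1: "hits (ray s 0) y L" unfolding hits_def w_def using wL[OF l(1,2)] by blast
    have "\<exists>l. 0 \<le> l \<and> l \<le> 1 \<and> cos t * w l $ 2 = sin t * w l $ 1"
    proof (rule cross)
      have "cos t * w 0 $ 2 \<le> 0" using y ct by (auto simp: w_def mult_le_0_iff)
      also have "0 \<le> sin t * w 0 $ 1" using w1[of 0] st by simp
      finally show "cos t * w 0 $ 2 \<le> sin t * w 0 $ 1" .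
      have "sin t * w 1 $ 1 \<le> sin t * (s * cos t)" using w1[of 1] st by (intro mult_left_mono) auto
      also have "\<dots> = cos t * (s * sin t)" by simp
      also have "\<dots> \<le> cos t * w 1 $ 2" using y ct by (intro mult_left_mono) (auto simp: w_def)
      finally show "sin t * w 1 $ 1 \<le> cos t * w 1 $ 2" .
    qed
    then obtain l where l: "0 \<le> l" "l \<le> 1" "cos t * w l $ 2 = sin t * w l $ 1" by auto
    have "w l = (w l $ 1 / cos t) *\<^sub>R dirv t"
      by (rule vec2_eqI) (use l ct in \<open>auto simp: field_simps\<close>)
    moreover have "w l $ 1 / cos t \<in> {0..s}" using w1[OF l(1,2)] ct by (auto simp: field_simps)
    ultimately have "w l \<in> ray s t" unfolding ray_def by blast
    hence 2: "hits (ray s t) y L" unfolding hits_def w_def using wL[OF l(1,2)] by blast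
    from 1 2 show "y \<in> {y. hits (ray s 0) y L \<and> hits (ray s t) y L}" by simp
  qed
  show ?thesis
  proof (cases "s * sin t \<le> width_orth (dirv 0) L")
    case True
    hence "ennreal ((s * cos t - 2 * D) * (width_orth (dirv 0) L - s * sin t)) = emeasure lborel ?C"
      unfolding emeasure_cbox_vec2 pq(5) using s(2) by (auto simp: algebra_simps)
    also have "\<dots> \<le> emeasure lborel {y. hits (ray s 0) y L \<and> hits (ray s t) y L}"
      by (rule emeasure_mono[OF sub]) (use sets in simp)
    finally show ?thesis .
  next
    case False
    \<comment> \<open>The box is empty here, but the claimed bound is then nonpositive and
      \<open>ennreal\<close> truncates it to 0.\<close>
    hence "(s * cos t - 2 * D) * (width_orth (dirv 0) L - s * sin t) \<le> 0"
      using s(2) by (simp add: mult_nonneg_nonpos)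
    thus ?thesis by (simp add: ennreal_neg)
  qed
qed

text \<open>A chord between the boundary rays of a sector meets every ray of the sector, and within
  distance \<open>s\<close> because the disc of radius \<open>s\<close> is convex.\<close>

lemma convex_meets_intermediate_ray:
  assumes C: "convex C" "C \<inter> ray s a \<noteq> {}" "C \<inter> ray s b \<noteq> {}" and ab: "a \<le> c" "c \<le> b" "b - a < pi"
  shows "C \<inter> ray s c \<noteq> {}"
proof -
  obtain al be where al: "al *\<^sub>R dirv a \<in> C" "0 \<le> al" "al \<le> s" and be: "be *\<^sub>R dirv b \<in> C" "0 \<le> be" "be \<le> s"
    using C(2,3) by (auto simp: ray_def)
  show ?thesis
  proof (cases "a = b \<or> al = 0 \<or> be = 0")
    \<comment> \<open>An endpoint at the origin lies on every ray, and for \<open>a = b\<close> the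
      three rays coincide. Outside these cases division by \<open>al\<close> and \<open>be\<close>
      is legitimate.\<close>
    case True
    hence "al *\<^sub>R dirv a \<in> ray s c \<or> be *\<^sub>R dirv b \<in> ray s c"
    proof (elim disjE)
      assume "a = b" thus ?thesis using ab al by (auto simp: ray_def)
    next
      assume "al = 0" thus ?thesis using al by (auto simp: ray_def intro!: image_eqI[of _ _ 0])
    next
      assume "be = 0" thus ?thesis using be by (auto simp: ray_def intro!: image_eqI[of _ _ 0])
    qed
    thus ?thesis using al be by blast
  next
    case False
    hence pos: "al > 0" "be > 0" "a < b" using al be ab by auto
    have sn: "sin (b - a) > 0" using pos ab by (intro sin_gt_zero) auto
    have s1: "sin (b - c) \<ge> 0" "sin (c - a) \<ge> 0" using ab by (intro sin_ge_zero; simp)+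
    \<comment> \<open>The sine addition formulas express a positive multiple of
      \<open>dirv c\<close> through \<open>dirv a\<close> and \<open>dirv b\<close> with
      coefficients \<open>sin (b - c)\<close> and \<open>sin (c - a)\<close>. Dividing these by
      \<open>al\<close> and \<open>be\<close> and normalising gives the convex weights with which
      the two endpoints combine to a point in direction \<open>c\<close>.\<close>
    define A where "A = sin (b - c) / al"
    define B where "B = sin (c - a) / be"
    have AB: "0 \<le> A" "0 \<le> B" using s1 pos by (auto simp: A_def B_def)
    have "sin (b - a) = sin (b - c) * cos (c - a) + cos (b - c) * sin (c - a)"
      using sin_add[of "b - c" "c - a"] by simp
    hence "A + B \<noteq> 0"
      using AB sn pos by (auto simp: add_nonneg_eq_0_iff A_def B_def)
    hence S: "A + B > 0" using AB by linarith
    have key: "sin (b - a) *\<^sub>R dirv c = sin (b - c) *\<^sub>R dirv a + sin (c - a) *\<^sub>R dirv b"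
    proof (rule vec2_eqI)
      show "(sin (b - a) *\<^sub>R dirv c) $ 1 = (sin (b - c) *\<^sub>R dirv a + sin (c - a) *\<^sub>R dirv b) $ 1"
        by (simp add: sin_diff algebra_simps)
      show "(sin (b - a) *\<^sub>R dirv c) $ 2 = (sin (b - c) *\<^sub>R dirv a + sin (c - a) *\<^sub>R dirv b) $ 2"
        by (simp add: sin_diff algebra_simps)
    qed
    define z where "z = sin (b - a) / (A + B)"
    have z0: "z \<ge> 0" using sn S by (simp add: z_def)
    have "z *\<^sub>R dirv c = (1 / (A + B)) *\<^sub>R (sin (b - a) *\<^sub>R dirv c)" by (simp add: z_def)
    also have "\<dots> = (A / (A + B)) *\<^sub>R (al *\<^sub>R dirv a) + (B / (A + B)) *\<^sub>R (be *\<^sub>R dirv b)"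
      unfolding key using pos by (simp add: A_def B_def scaleR_add_right)
    finally have zc: "z *\<^sub>R dirv c = (A / (A + B)) *\<^sub>R (al *\<^sub>R dirv a) + (B / (A + B)) *\<^sub>R (be *\<^sub>R dirv b)" .
    have co: "0 \<le> A / (A + B)" "0 \<le> B / (A + B)" "A / (A + B) + B / (A + B) = 1"
      using AB S by (auto simp: add_divide_distrib[symmetric])
    have "z *\<^sub>R dirv c \<in> C" unfolding zc by (rule convexD[OF C(1) al(1) be(1) co])
    moreover have "z *\<^sub>R dirv c \<in> cball 0 s"
      unfolding zc by (rule convexD[OF convex_cball _ _ co]) (use al be in auto)
    hence "z *\<^sub>R dirv c \<in> ray s c" using z0 by (auto simp: ray_def)
    ultimately show ?thesis by blast
  qed
qed

lemma hits_intermediate_ray: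
  assumes "convex L" "hits (ray s a) y L" "hits (ray s b) y L" "a \<le> c" "c \<le> b" "b - a < pi"
  shows "hits (ray s c) y L"
proof -
  have *: "hits S y L \<longleftrightarrow> (+) y ` L \<inter> S \<noteq> {}" for S by (auto simp: hits_def)
  show ?thesis using assms convex_meets_intermediate_ray[of "(+) y ` L"] convex_translation[of L y]
    unfolding * by blast
qed


section \<open>Boundedness and joint measurability of the width\<close>

lemma subset_cball_diameter:
  fixes L :: "'a::euclidean_space set"
  assumes "convex_body L" "0 \<in> L" "diameter L \<le> D"
  shows "L \<subseteq> cball 0 D"
proof
  fix z assume "z \<in> L"
  thus "z \<in> cball 0 D"
    using diameter_bounded_bound[of L z 0] assms by (auto simp: convex_body_def compact_imp_bounded)
qed

lemma width_orth_bounds: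
  assumes "convex_body L"
  shows "bdd_above {(y - x) \<bullet> perp u |x y. x \<in> L \<and> y \<in> L}" and "0 \<le> width_orth u L"
    and "L \<subseteq> cball 0 D \<Longrightarrow> width_orth u L \<le> 2 * D * norm u"
proof -
  have perp: "norm (perp u) = norm u" by (simp add: perp_eq_rot norm_rot)
  have *: "a \<le> 2 * D * norm u" if sub: "L \<subseteq> cball 0 D" and a: "a \<in> {(y - x) \<bullet> perp u |x y. x \<in> L \<and> y \<in> L}" for a D
  proof -
    obtain x y where xy: "x \<in> L" "y \<in> L" "a = (y - x) \<bullet> perp u" using a by blast
    have "a \<le> norm (y - x) * norm u" unfolding xy perp[symmetric] by (rule norm_cauchy_schwarz)
    also have "norm (y - x) \<le> 2 * D"
      using norm_triangle_ineq4[of y x] subsetD[OF sub xy(1)] subsetD[OF sub xy(2)] by simp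
    finally show ?thesis by (simp add: mult_right_mono)
  qed
  obtain x where x: "x \<in> L" using assms by (auto simp: convex_body_def)
  hence mem: "(x - x) \<bullet> perp u \<in> {(y - x) \<bullet> perp u |x y. x \<in> L \<and> y \<in> L}" by blast
  hence ne: "{(y - x) \<bullet> perp u |x y. x \<in> L \<and> y \<in> L} \<noteq> {}" by blast
  have "bounded L" using assms by (simp add: convex_body_def compact_imp_bounded)
  then obtain R where "\<forall>z\<in>L. norm z \<le> R" unfolding bounded_iff ..
  hence "L \<subseteq> cball 0 R" by auto
  thus bdd: "bdd_above {(y - x) \<bullet> perp u |x y. x \<in> L \<and> y \<in> L}" by (rule bdd_aboveI[OF *])
  from cSup_upper[OF mem bdd] show "0 \<le> width_orth u L" by (simp add: width_orth_def)
  show "width_orth u L \<le> 2 * D * norm u" if "L \<subseteq> cball 0 D"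
    unfolding width_orth_def by (rule cSup_least[OF ne *[OF that]])
qed

text \<open>A width exceeding \<open>a\<close> is witnessed by two points of \<open>L\<close>, which
  can be replaced by nearby points of a countable dense set at the price of an error
  \<open>2 * ?e k * norm (perp u)\<close>. Building this error into the threshold of
  \<open>?U\<close> makes the approximate condition sufficient as well; it is an open condition on
  \<open>u\<close> times two hits of open balls by \<open>L\<close>. Measurability is joint because
  the mean width integrates over the direction.\<close>

lemma measurable_width_orth:
  "(\<lambda>p. width_orth (fst p) (snd p)) \<in> borel_measurable (borel \<Otimes>\<^sub>M convex_bodies)"
proof (subst borel_measurable_iff_greater, rule allI)
  fix a :: real
  obtain Q :: "(real^2) set" where Q: "countable Q" "\<And>U. open U \<Longrightarrow> U \<noteq> {} \<Longrightarrow> \<exists>q\<in>Q. q \<in> U"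
    using countable_dense_exists by metis
  let ?e = "\<lambda>k::nat. 1 / real (Suc k)"
  let ?U = "\<lambda>k q q'. {u \<in> space borel. a < (q' - q) \<bullet> perp u - 2 * ?e k * norm (perp u)}"
  let ?L = "\<lambda>k q. {L \<in> space convex_bodies. L \<inter> ball q (?e k) \<noteq> {}}"
  have diff: "\<bar>(y - x) \<bullet> v - (q' - q) \<bullet> v\<bar> \<le> 2 * e * norm v"
    if "dist x q < e" "dist y q' < e" for x y q q' v :: "real^2" and e
  proof -
    have "\<bar>(y - x) \<bullet> v - (q' - q) \<bullet> v\<bar> = \<bar>((y - q') - (x - q)) \<bullet> v\<bar>" by (simp add: inner_diff_left)
    also have "\<dots> \<le> norm ((y - q') - (x - q)) * norm v" by (rule Cauchy_Schwarz_ineq2)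
    also have "norm ((y - q') - (x - q)) \<le> norm (y - q') + norm (x - q)" by (rule norm_triangle_ineq4)
    also have "\<dots> \<le> 2 * e" using that by (simp add: dist_norm)
    finally show ?thesis by (simp add: mult_right_mono)
  qed
  have eq: "a < width_orth u L \<longleftrightarrow> (\<exists>k. \<exists>q\<in>Q. \<exists>q'\<in>Q. (u, L) \<in> ?U k q q' \<times> (?L k q \<inter> ?L k q'))"
    if L: "convex_body L" for u L
  proof -
    obtain x where "x \<in> L" using L by (auto simp: convex_body_def)
    hence ne: "{(y - x) \<bullet> perp u |x y. x \<in> L \<and> y \<in> L} \<noteq> {}" by blast
    have "a < width_orth u L \<longleftrightarrow> (\<exists>x\<in>L. \<exists>y\<in>L. a < (y - x) \<bullet> perp u)"
      unfolding width_orth_def less_cSup_iff[OF ne width_orth_bounds(1)[OF L]] by blast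
    also have "\<dots> \<longleftrightarrow> (\<exists>k. \<exists>q\<in>Q. \<exists>q'\<in>Q. (u, L) \<in> ?U k q q' \<times> (?L k q \<inter> ?L k q'))"
    proof
      assume "\<exists>x\<in>L. \<exists>y\<in>L. a < (y - x) \<bullet> perp u"
      then obtain x y where xy: "x \<in> L" "y \<in> L" "a < (y - x) \<bullet> perp u" by blast
      \<comment> \<open>Twice the error: once for moving from \<open>x\<close>, \<open>y\<close> to
        \<open>q\<close>, \<open>q'\<close>, once for the margin inside \<open>?U\<close>.\<close>
      have "(\<lambda>k. 4 * ?e k * norm (perp u)) \<longlonglongrightarrow> 0" by real_asymp
      hence "\<forall>\<^sub>F k in sequentially. 4 * ?e k * norm (perp u) < (y - x) \<bullet> perp u - a"
        using xy(3) by (intro order_tendstoD) auto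
      then obtain k where k: "4 * ?e k * norm (perp u) < (y - x) \<bullet> perp u - a"
        by (auto simp: eventually_sequentially)
      have ex: "\<exists>q\<in>Q. dist z q < ?e k" for z using Q(2)[of "ball z (?e k)"] by auto
      obtain q q' where q: "q \<in> Q" "q' \<in> Q" "dist x q < ?e k" "dist y q' < ?e k" using ex by metis
      have "a < (q' - q) \<bullet> perp u - 2 * ?e k * norm (perp u)"
        using diff[OF q(3,4), of "perp u"] k by linarith
      moreover have "x \<in> L \<inter> ball q (?e k)" "y \<in> L \<inter> ball q' (?e k)" using q xy by (auto simp: dist_commute)
      ultimately have "(u, L) \<in> ?U k q q' \<times> (?L k q \<inter> ?L k q')"
        using L by (auto simp: space_convex_bodies simp del: mem_ball)
      thus "\<exists>k. \<exists>q\<in>Q. \<exists>q'\<in>Q. (u, L) \<in> ?U k q q' \<times> (?L k q \<inter> ?L k q')" using q(1,2) by blast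
    next
      assume "\<exists>k. \<exists>q\<in>Q. \<exists>q'\<in>Q. (u, L) \<in> ?U k q q' \<times> (?L k q \<inter> ?L k q')"
      then obtain k q q' where k: "(u, L) \<in> ?U k q q' \<times> (?L k q \<inter> ?L k q')" by blast
      then obtain x y where xy: "x \<in> L" "y \<in> L" "dist x q < ?e k" "dist y q' < ?e k"
        by (auto simp: dist_commute disjoint_iff)
      have "a < (y - x) \<bullet> perp u" using diff[OF xy(3,4), of "perp u"] k by auto
      thus "\<exists>x\<in>L. \<exists>y\<in>L. a < (y - x) \<bullet> perp u" using xy by blast
    qed
    finally show ?thesis .
  qed
  have "{p \<in> space (borel \<Otimes>\<^sub>M convex_bodies). a < width_orth (fst p) (snd p)} =
    (\<Union>k. \<Union>q\<in>Q. \<Union>q'\<in>Q. ?U k q q' \<times> (?L k q \<inter> ?L k q'))"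
  proof (rule set_eqI)
    fix p :: "(real^2) \<times> (real^2) set"
    obtain u L where p: "p = (u, L)" by (cases p)
    show "p \<in> {p \<in> space (borel \<Otimes>\<^sub>M convex_bodies). a < width_orth (fst p) (snd p)} \<longleftrightarrow>
      p \<in> (\<Union>k. \<Union>q\<in>Q. \<Union>q'\<in>Q. ?U k q q' \<times> (?L k q \<inter> ?L k q'))"
    proof (cases "convex_body L")
      case True
      show ?thesis using eq[OF True, of u] True unfolding p by (simp add: space_pair_measure space_convex_bodies)
    next
      case False
      thus ?thesis unfolding p by (auto simp: space_pair_measure space_convex_bodies)
    qed
  qed
  also have "\<dots> \<in> sets (borel \<Otimes>\<^sub>M convex_bodies)"
  proof (intro sets.countable_UN sets.countable_UN'' Q(1) image_subsetI pair_measureI sets.Int hit_open_in_sets open_ball)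
    fix k q q'
    have "continuous_on UNIV (perp :: real^2 \<Rightarrow> real^2)"
      unfolding perp_eq_rot by (rule matrix_vector_mult_linear_continuous_on)
    hence "open {u. a < (q' - q) \<bullet> perp u - 2 * ?e k * norm (perp u)}"
      by (intro open_Collect_less continuous_intros)
    thus "?U k q q' \<in> sets borel" by simp
  qed
  finally show "{p \<in> space (borel \<Otimes>\<^sub>M convex_bodies). a < width_orth (fst p) (snd p)}
    \<in> sets (borel \<Otimes>\<^sub>M convex_bodies)" .
qed

subsection \<open>Free rays\<close>

lemma continuous_dirv: "continuous_on UNIV dirv"
proof -
  have "continuous_on UNIV (\<lambda>t. cos t *\<^sub>R dirv 0 + sin t *\<^sub>R dirv (pi / 2))"
    by (intro continuous_intros)
  moreover have "(\<lambda>t. cos t *\<^sub>R dirv 0 + sin t *\<^sub>R dirv (pi / 2)) = dirv"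
    by (intro ext vec2_eqI) simp_all
  ultimately show ?thesis by (rule back_subst[where P = "continuous_on UNIV"])
qed

lemma measurable_dirv [measurable]: "dirv \<in> borel_measurable borel"
  by (rule borel_measurable_continuous_onI) (rule continuous_dirv)

lemma compact_ray: "compact (ray s t)"
  unfolding ray_def by (intro compact_continuous_image continuous_intros) simp

lemma closed_ray: "closed (ray s t)"
  by (rule compact_imp_closed) (rule compact_ray)

lemma ray_subset_cball: "ray s t \<subseteq> cball 0 s"
  by (auto simp: ray_def)

lemma unit_vector_eq_dirv:
  assumes "norm u = 1"
  obtains t where "0 \<le> t" "t < 2 * pi" "u = dirv t"
proof -
  have "(u $ 1)\<^sup>2 + (u $ 2)\<^sup>2 = 1"
    using assms by (simp add: norm_vec_def L2_set_def sum_2)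
  from sincos_total_2pi[OF this] obtain t where "0 \<le> t" "t < 2 * pi" "u $ 1 = cos t" "u $ 2 = sin t" by metis
  thus ?thesis using that vec2_eqI[of u "dirv t"] by simp
qed

lemma hits_eq: "hits S y L \<longleftrightarrow> {y + z |z. z \<in> L} \<inter> S \<noteq> {}"
  by (auto simp: hits_def)

lemma occupied_disjoint_iff: "occupied x Z \<inter> S = {} \<longleftrightarrow> (\<forall>n. \<not> hits S (x n) (Z n))"
  unfolding occupied_def hits_eq by blast

lemma total_visibility_ge:
  assumes "occupied x Z \<inter> ray r t = {}"
  shows "ereal r \<le> total_visibility (occupied x Z)"
proof -
  have "ereal r \<le> visibility (occupied x Z) (dirv t)"
    unfolding visibility_def
  proof (rule Inf_greatest)
    fix a assume "a \<in> {ereal s |s. 0 < s \<and> s *\<^sub>R dirv t \<in> occupied x Z}"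
    then obtain s where s: "a = ereal s" "0 < s" "s *\<^sub>R dirv t \<in> occupied x Z" by auto
    have "s \<notin> {0..r}" using s(3) assms unfolding ray_def by blast
    thus "ereal r \<le> a" using s by auto
  qed
  also have "\<dots> \<le> total_visibility (occupied x Z)"
    unfolding total_visibility_def by (rule SUP_upper) simp
  finally show ?thesis .
qed

text \<open>The supremum over directions need not be attained, so a free segment is claimed only for
  lengths strictly below it. The origin is treated separately, since \<open>visibility\<close>
  considers positive distances only.\<close>

lemma total_visibility_gt_imp:
  assumes "ereal s < total_visibility (occupied x Z)" "0 \<notin> occupied x Z"
  obtains t where "0 \<le> t" "t < 2 * pi" "occupied x Z \<inter> ray s t = {}"
proof -
  obtain u where u: "norm u = 1" "ereal s < visibility (occupied x Z) u"
    using assms(1) unfolding total_visibility_def less_SUP_iff by auto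
  obtain t where t: "0 \<le> t" "t < 2 * pi" "u = dirv t" using unit_vector_eq_dirv[OF u(1)] .
  have "z *\<^sub>R u \<notin> occupied x Z" if "0 \<le> z" "z \<le> s" for z
  proof (cases "z = 0")
    case False
    show ?thesis
    proof
      assume "z *\<^sub>R u \<in> occupied x Z"
      hence "visibility (occupied x Z) u \<le> ereal z"
        unfolding visibility_def by (intro Inf_lower) (use False that in auto)
      thus False using u(2) that by (meson ereal_less_eq(3) leD le_less_trans order_trans)
    qed
  qed (use assms in simp)
  hence "occupied x Z \<inter> ray s t = {}" by (auto simp: ray_def t(3))
  with t that show ?thesis by blast
qed

text \<open>Only finitely many grains reach the disc containing the segment, so their union is closed there
  and the segment can be turned slightly.\<close>

lemma free_ray_rational:
  assumes Z: "\<And>n. convex_body (Z n)" "\<And>n. Z n \<subseteq> cball 0 D"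
    and x: "finite {n. x n \<in> cball 0 (s + D)}"
    and t: "0 \<le> t" "t < 2 * pi" and free: "occupied x Z \<inter> ray s t = {}"
  obtains q where "q \<in> \<rat>" "0 \<le> q" "q < 2 * pi" "occupied x Z \<inter> ray s q = {}"
proof (cases "s \<ge> 0")
  case False
  hence "ray s 0 = {}" by (simp add: ray_def)
  thus ?thesis using that[of 0] by simp
next
  case s: True
  define C where "C = (\<Union>n\<in>{n. x n \<in> cball 0 (s + D)}. (+) (x n) ` Z n)"
  have occ: "occupied x Z \<inter> cball 0 s \<subseteq> C"
  proof
    fix v assume v: "v \<in> occupied x Z \<inter> cball 0 s"
    then obtain n z where n: "v = x n + z" "z \<in> Z n" by (auto simp: occupied_def)
    have "norm (x n) \<le> norm v + norm z" using norm_triangle_ineq4[of v z] n by simp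
    hence "x n \<in> cball 0 (s + D)" using v Z(2)[of n] n(2) by force
    thus "v \<in> C" using n by (auto simp: C_def)
  qed
  have Cocc: "C \<subseteq> occupied x Z" by (auto simp: C_def occupied_def)
  have "closed C"
    unfolding C_def using x Z(1)
    by (intro closed_UN ballI compact_imp_closed compact_translation) (auto simp: convex_body_def)
  then obtain d where d: "d > 0" "\<And>a b. a \<in> ray s t \<Longrightarrow> b \<in> C \<Longrightarrow> d \<le> dist a b"
    using separate_compact_closed[of "ray s t" C] compact_ray free Cocc by blast
  \<comment> \<open>It suffices to control the far end: a point at distance \<open>z \<le> s\<close>
    from the origin moves by at most as much when the segment turns.\<close>
  have "continuous (at t) (\<lambda>t. s *\<^sub>R dirv t)"
    using continuous_dirv by (intro continuous_intros) (simp add: continuous_on_eq_continuous_at)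
  then obtain e where e: "e > 0" "\<And>t'. dist t' t < e \<Longrightarrow> dist (s *\<^sub>R dirv t') (s *\<^sub>R dirv t) < d"
    using d(1) unfolding continuous_at_eps_delta by blast
  \<comment> \<open>Turning in the positive direction stays in the half-open interval even for
    \<open>t = 0\<close>.\<close>
  obtain q where q: "q \<in> \<rat>" "t < q" "q < min (t + e) (2 * pi)"
    using Rats_dense_in_real[of t "min (t + e) (2 * pi)"] t e by auto
  have "occupied x Z \<inter> ray s q = {}"
  proof (rule ccontr)
    assume "occupied x Z \<inter> ray s q \<noteq> {}"
    then obtain z where z: "0 \<le> z" "z \<le> s" "z *\<^sub>R dirv q \<in> occupied x Z" by (auto simp: ray_def)
    hence "z *\<^sub>R dirv q \<in> C" using occ by auto
    moreover have "z *\<^sub>R dirv t \<in> ray s t" using z by (auto simp: ray_def)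
    ultimately have "d \<le> dist (z *\<^sub>R dirv t) (z *\<^sub>R dirv q)" using d by blast
    also have "\<dots> = z * norm (dirv t - dirv q)" using z by (simp add: dist_norm scaleR_diff_right[symmetric])
    also have "\<dots> \<le> s * norm (dirv t - dirv q)" using z by (intro mult_right_mono) auto
    also have "\<dots> = dist (s *\<^sub>R dirv q) (s *\<^sub>R dirv t)"
      using s by (simp add: dist_norm scaleR_diff_right[symmetric] norm_minus_commute)
    also have "\<dots> < d" using q by (intro e(2)) (auto simp: dist_real_def)
    finally show False by simp
  qed
  with q t that show ?thesis by auto
qed

lemma sector_exists:
  assumes "m > 0" "0 \<le> q" "q < 2 * pi"
  obtains i where "i < m" "real i * (2 * pi / real m) \<le> q" "q \<le> real i * (2 * pi / real m) + 2 * pi / real m"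
proof -
  define v where "v = q / (2 * pi / real m)"
  define i where "i = nat \<lfloor>v\<rfloor>"
  have v: "0 \<le> v" "v < real m" using assms by (auto simp: v_def field_simps)
  have i: "real i \<le> v" "v \<le> real i + 1" "i < m" using v unfolding i_def by linarith+
  have q: "q = v * (2 * pi / real m)" using assms by (simp add: v_def)
  have "real i * (2 * pi / real m) \<le> q" unfolding q using i by (intro mult_right_mono) auto
  moreover have "q \<le> (real i + 1) * (2 * pi / real m)" unfolding q using i by (intro mult_right_mono) auto
  ultimately show ?thesis using i(3) that[of i] by (simp only: distrib_right mult_1_left)
qed

subsection \<open>The planar Boolean model\<close>

locale planar_boolean_model =
  N: prob_space N + M: prob_space M
  for N :: "'v measure" and M :: "'w measure" +
  fixes K :: "'v \<Rightarrow> (real^2) set"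
    and X :: "'w \<Rightarrow> (real^2) set"
    and x :: "nat \<Rightarrow> 'w \<Rightarrow> real^2"
    and Z :: "nat \<Rightarrow> 'w \<Rightarrow> (real^2) set"
    and D :: real
  assumes K [measurable]: "K \<in> measurable N convex_bodies"
    and zero_in_K: "AE \<omega> in N. 0 \<in> K \<omega>"
    and rotation_invariant: "\<And>R :: real^2^2. rotation_matrix R \<Longrightarrow>
           distr N convex_bodies (\<lambda>\<omega>. (\<lambda>y. R *v y) ` K \<omega>) = distr N convex_bodies K"
    and diameter_K: "AE \<omega> in N. diameter (K \<omega>) \<le> D"
    and X: "unit_poisson_process M X"
    and grains: "iid_grains M X (distr N convex_bodies K) x Z"
begin

definition Q :: "(real^2) set measure" where "Q = distr N convex_bodies K"

text \<open>The width across one fixed direction stands for all of them;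
  \<open>integral_mean_width\<close> identifies its expectation with that of the mean width.\<close>

definition expected_width :: real where
  "expected_width = (\<integral>\<omega>. width_orth (dirv 0) (K \<omega>) \<partial>N)"

lemma sets_Q [measurable_cong]: "sets Q = sets convex_bodies" by (simp add: Q_def)

sublocale Q: prob_space Q
  unfolding Q_def by (rule N.prob_space_distr) (rule K)

lemma space_Q: "space Q = {L. convex_body L}"
  by (simp add: Q_def space_convex_bodies)

lemma convex_body_K: "\<omega> \<in> space N \<Longrightarrow> convex_body (K \<omega>)"
  using measurable_space[OF K] by (simp add: space_convex_bodies)

lemma K_bounded: "AE \<omega> in N. K \<omega> \<subseteq> cball 0 D"
  using zero_in_K diameter_K AE_space
  by eventually_elim (intro subset_cball_diameter convex_body_K)

text \<open>Being contained in a closed ball means not hitting its open complement, hence is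
  measurable, and the almost sure bound passes from \<open>K\<close> to its law.\<close>

lemma Q_bounded: "AE L in Q. L \<subseteq> cball 0 D"
proof -
  have "{L \<in> space convex_bodies. L \<inter> - cball (0::real^2) D \<noteq> {}} \<in> sets convex_bodies"
    by (rule hit_open_in_sets) (simp add: open_Compl)
  hence "space convex_bodies - {L \<in> space convex_bodies. L \<inter> - cball (0::real^2) D \<noteq> {}} \<in> sets convex_bodies"
    by (rule sets.compl_sets)
  moreover have "space convex_bodies - {L \<in> space convex_bodies. L \<inter> - cball (0::real^2) D \<noteq> {}}
      = {L \<in> space convex_bodies. L \<subseteq> cball 0 D}" by blast
  ultimately show ?thesis using K_bounded unfolding Q_def by (subst AE_distr_iff) auto
qed

lemma AE_grains: "AE \<omega> in M. \<forall>n. convex_body (Z n \<omega>) \<and> Z n \<omega> \<subseteq> cball 0 D"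
proof (subst AE_all_countable, rule allI)
  fix n
  have Z: "Z n \<in> measurable M convex_bodies" "distr M convex_bodies (Z n) = Q"
    using grains unfolding iid_grains_def Q_def by auto
  have "AE L in distr M convex_bodies (Z n). L \<subseteq> cball 0 D" using Q_bounded by (simp only: Z(2))
  hence "AE \<omega> in M. Z n \<omega> \<subseteq> cball 0 D" by (rule AE_distrD[OF Z(1)])
  thus "AE \<omega> in M. convex_body (Z n \<omega>) \<and> Z n \<omega> \<subseteq> cball 0 D"
    using AE_space by eventually_elim (use measurable_space[OF Z(1)] in \<open>auto simp: space_convex_bodies\<close>)
qed

lemma measurable_width_K [measurable]: "(\<lambda>\<omega>. width_orth u (K \<omega>)) \<in> borel_measurable N"
proof -
  have "(\<lambda>\<omega>. (u, K \<omega>)) \<in> measurable N (borel \<Otimes>\<^sub>M convex_bodies)" by measurable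
  from measurable_compose[OF this measurable_width_orth] show ?thesis by simp
qed

lemma integrable_width: "integrable N (\<lambda>\<omega>. width_orth u (K \<omega>))"
proof (rule N.integrable_const_bound[where B = "2 * D * norm u"])
  show "AE \<omega> in N. norm (width_orth u (K \<omega>)) \<le> 2 * D * norm u"
    using K_bounded AE_space
    by eventually_elim (use width_orth_bounds(2,3) convex_body_K in auto)
qed measurable

text \<open>\<open>K\<close> and its rotation by \<open>t\<close> have the same law, and the width
  of the rotated body across \<open>dirv t\<close> is that of the body across
  \<open>dirv 0\<close>.\<close>

lemma integral_width_rot: "(\<integral>\<omega>. width_orth (dirv t) (K \<omega>) \<partial>N) = expected_width"
proof -
  have m: "(\<lambda>L. width_orth (dirv t) L) \<in> borel_measurable convex_bodies"
    using measurable_compose[OF measurable_Pair1' measurable_width_orth, of "dirv t"] by simp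
  have "(\<integral>\<omega>. width_orth (dirv t) (K \<omega>) \<partial>N) = (\<integral>L. width_orth (dirv t) L \<partial>distr N convex_bodies K)"
    by (rule integral_distr[symmetric]) (use m K in auto)
  also have "\<dots> = (\<integral>L. width_orth (dirv t) L \<partial>distr N convex_bodies (\<lambda>\<omega>. (*v) (rot t) ` K \<omega>))"
    by (simp only: rotation_invariant[OF rotation_matrix_rot])
  also have "\<dots> = (\<integral>\<omega>. width_orth (dirv t) ((*v) (rot t) ` K \<omega>) \<partial>N)"
    by (rule integral_distr) (use m measurable_image_rot[OF K] in auto)
  finally show ?thesis by (simp only: width_orth_rot expected_width_def)
qed

lemma expected_width_nonneg: "0 \<le> expected_width"
  unfolding expected_width_def
  by (rule Bochner_Integration.integral_nonneg_AE) (use AE_space in \<open>eventually_elim, auto intro: width_orth_bounds convex_body_K\<close>)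

text \<open>Exchanging the integrals over angle and sample leaves \<open>expected_width\<close> for
  every angle; the total length \<open>2 * pi\<close> cancels the normalisation.\<close>

lemma integral_mean_width: "(\<integral>\<omega>. mean_width (K \<omega>) \<partial>N) = expected_width"
proof -
  let ?R = "restrict_space lborel {0..<2 * pi}"
  have emR: "emeasure ?R (space ?R) = ennreal (2 * pi)"
    by (simp add: emeasure_restrict_space space_restrict_space)
  interpret R: finite_measure ?R
    by (rule finite_measureI) (unfold emR, simp)
  interpret P: pair_sigma_finite ?R N ..
  have mt: "dirv \<in> borel_measurable ?R" by (intro measurable_restrict_space1) simp
  have arc: "arc_length_measure = distr ?R borel dirv"
    by (simp add: arc_length_measure_def dirv_def[abs_def])
  have meas: "(\<lambda>(t, \<omega>). width_orth (dirv t) (K \<omega>)) \<in> borel_measurable (?R \<Otimes>\<^sub>M N)"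
  proof -
    have "(\<lambda>p. (dirv (fst p), K (snd p))) \<in> measurable (?R \<Otimes>\<^sub>M N) (borel \<Otimes>\<^sub>M convex_bodies)"
      using mt by measurable
    from measurable_compose[OF this measurable_width_orth] show ?thesis by (simp add: case_prod_beta')
  qed
  have int: "integrable (?R \<Otimes>\<^sub>M N) (\<lambda>(t, \<omega>). width_orth (dirv t) (K \<omega>))"
  proof (rule P.Fubini_integrable[OF meas])
    \<comment> \<open>Constant in \<open>t\<close>, hence integrable over a measure of mass
      \<open>2 * pi\<close>.\<close>
    have "(\<integral>\<omega>. norm (width_orth (dirv t) (K \<omega>)) \<partial>N) = expected_width" for t
      unfolding integral_width_rot[of t, symmetric]
      by (intro Bochner_Integration.integral_cong refl) (use width_orth_bounds(2) convex_body_K in auto)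
    thus "integrable ?R (\<lambda>t. \<integral>\<omega>. norm (case (t, \<omega>) of (t, \<omega>) \<Rightarrow> width_orth (dirv t) (K \<omega>)) \<partial>N)"
      by simp
    show "AE t in ?R. integrable N (\<lambda>\<omega>. case (t, \<omega>) of (t, \<omega>) \<Rightarrow> width_orth (dirv t) (K \<omega>))"
      using integrable_width by simp
  qed
  have "(\<integral>\<omega>. mean_width (K \<omega>) \<partial>N) = (\<integral>\<omega>. 1 / (2 * pi) * (\<integral>t. width_orth (dirv t) (K \<omega>) \<partial>?R) \<partial>N)"
  proof (intro Bochner_Integration.integral_cong refl)
    fix \<omega> assume "\<omega> \<in> space N"
    hence "K \<omega> \<in> space convex_bodies" by (simp add: space_convex_bodies convex_body_K)
    hence "(\<lambda>u. width_orth u (K \<omega>)) \<in> borel_measurable borel"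
      using measurable_compose[OF measurable_Pair2' measurable_width_orth, of "K \<omega>"] by simp
    thus "mean_width (K \<omega>) = 1 / (2 * pi) * (\<integral>t. width_orth (dirv t) (K \<omega>) \<partial>?R)"
      unfolding mean_width_def arc using mt by (simp add: integral_distr)
  qed
  also have "\<dots> = 1 / (2 * pi) * (\<integral>\<omega>. (\<integral>t. width_orth (dirv t) (K \<omega>) \<partial>?R) \<partial>N)"
    by simp
  also have "(\<integral>\<omega>. (\<integral>t. width_orth (dirv t) (K \<omega>) \<partial>?R) \<partial>N) = (\<integral>t. (\<integral>\<omega>. width_orth (dirv t) (K \<omega>) \<partial>N) \<partial>?R)"
    by (rule P.Fubini_integral[OF int])
  also have "\<dots> = 2 * pi * expected_width"
    unfolding integral_width_rot using emR by (simp add: measure_def)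
  finally show ?thesis by simp
qed

section \<open>Hitting intensities and the probability of no hit\<close>

definition hit_both :: "(real^2) set \<Rightarrow> (real^2) set \<Rightarrow> ((real^2) \<times> (real^2) set) set" where
  "hit_both S T = {p \<in> space (borel \<Otimes>\<^sub>M convex_bodies). hits S (fst p) (snd p) \<and> hits T (fst p) (snd p)}"

text \<open>The exponent of the void probability with the integrals exchanged: an area averaged over
  grains, which the geometric estimates control, instead of a hitting probability integrated over
  positions. \<open>S = T\<close> covers the case of a single set.\<close>

definition hit_intensity :: "(real^2) set \<Rightarrow> (real^2) set \<Rightarrow> ennreal" where
  "hit_intensity S T = (\<integral>\<^sup>+ \<omega>. emeasure lborel {y. hits S y (K \<omega>) \<and> hits T y (K \<omega>)} \<partial>N)"

lemma hit_both_sets [measurable]: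
  assumes "closed S" "closed T"
  shows "hit_both S T \<in> sets (borel \<Otimes>\<^sub>M convex_bodies)"
proof -
  have "hit_both S T = {p \<in> space (borel \<Otimes>\<^sub>M convex_bodies). hits S (fst p) (snd p)}
     \<inter> {p \<in> space (borel \<Otimes>\<^sub>M convex_bodies). hits T (fst p) (snd p)}"
    by (auto simp: hit_both_def)
  thus ?thesis using assms by (auto intro: hits_measurable)
qed

lemma hit_both_section:
  "convex_body L \<Longrightarrow> (\<lambda>y. (y, L)) -` hit_both S T = {y. hits S y L \<and> hits T y L}"
  by (auto simp: hit_both_def space_pair_measure space_convex_bodies)

lemma hit_points_sets:
  fixes S T :: "(real^2) set"
  assumes "closed S" "closed T" "convex_body L"
  shows "{y. hits S y L \<and> hits T y L} \<in> sets borel"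
  using sets_Pair2[OF hit_both_sets[OF assms(1,2)], of L] hit_both_section[OF assms(3)] by simp

lemma hit_emeasure_measurable:
  fixes S T :: "(real^2) set"
  assumes "closed S" "closed T"
  shows "(\<lambda>L. emeasure lborel {y. hits S y L \<and> hits T y L}) \<in> borel_measurable convex_bodies"
proof -
  have "hit_both S T \<in> sets (lborel \<Otimes>\<^sub>M Q)"
    using hit_both_sets[OF assms] by (simp cong: sets_pair_measure_cong add: sets_Q)
  interpret P: pair_sigma_finite lborel Q ..
  have "(\<lambda>L. emeasure lborel ((\<lambda>y. (y, L)) -` hit_both S T)) \<in> borel_measurable Q"
    by (rule P.measurable_emeasure_Pair2) fact
  hence "(\<lambda>L. emeasure lborel ((\<lambda>y. (y, L)) -` hit_both S T)) \<in> borel_measurable convex_bodies"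
    by simp
  thus ?thesis
    by (rule measurable_cong[THEN iffD1, rotated]) (simp add: hit_both_section space_convex_bodies)
qed

text \<open>Rotating position, grain and targets together preserves hits, and both the law of
  \<open>K\<close> and Lebesgue measure are invariant. This moves any arc of the circle to one
  starting at angle 0.\<close>

lemma hit_intensity_rot:
  assumes S: "closed S" and T: "closed T" and cl: "closed ((*v) (rot t) ` S)" "closed ((*v) (rot t) ` T)"
  shows "hit_intensity ((*v) (rot t) ` S) ((*v) (rot t) ` T) = hit_intensity S T"
proof -
  let ?f = "\<lambda>L. emeasure lborel {y. hits ((*v) (rot t) ` S) y L \<and> hits ((*v) (rot t) ` T) y L}"
  have m: "?f \<in> borel_measurable convex_bodies" by (rule hit_emeasure_measurable[OF cl])
  have rot: "?f ((*v) (rot t) ` L) = emeasure lborel {y. hits S y L \<and> hits T y L}" if "convex_body L" for L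
  proof -
    have "{y. hits S y L \<and> hits T y L} \<in> sets borel" by (rule hit_points_sets) fact+
    hence "emeasure (distr lborel borel ((*v) (rot (- t)))) {y. hits S y L \<and> hits T y L}
      = emeasure lborel ((*v) (rot (- t)) -` {y. hits S y L \<and> hits T y L} \<inter> space lborel)"
      using measurable_rot[of "- t"] by (intro emeasure_distr) auto
    thus ?thesis by (simp add: distr_lborel_rot hits_rot)
  qed
  have "hit_intensity ((*v) (rot t) ` S) ((*v) (rot t) ` T) = (\<integral>\<^sup>+ L. ?f L \<partial>distr N convex_bodies K)"
    unfolding hit_intensity_def by (rule nn_integral_distr[symmetric]) (use m K in auto)
  also have "\<dots> = (\<integral>\<^sup>+ L. ?f L \<partial>distr N convex_bodies (\<lambda>\<omega>. (*v) (rot t) ` K \<omega>))"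
    by (simp only: rotation_invariant[OF rotation_matrix_rot])
  also have "\<dots> = (\<integral>\<^sup>+ \<omega>. ?f ((*v) (rot t) ` K \<omega>) \<partial>N)"
    by (rule nn_integral_distr) (use m measurable_image_rot[OF K] in auto)
  also have "\<dots> = hit_intensity S T"
    unfolding hit_intensity_def by (intro nn_integral_cong rot convex_body_K)
  finally show ?thesis .
qed

text \<open>The void probability of \<open>hit_both S T\<close>. Almost surely grains reach no
  further than \<open>D\<close> from their points, so only positions in the ball of radius
  \<open>r + D\<close> matter, which makes the intensity finite; exchanging the integrals over
  \<open>lborel\<close> and \<open>Q\<close> rewrites the exponent as
  \<open>hit_intensity\<close>.\<close>

lemma no_hit_prob:
  assumes S: "closed S" and T: "closed T" and r: "S \<subseteq> cball 0 r"
  shows "{\<omega> \<in> space M. \<forall>n. \<not> (hits S (x n \<omega>) (Z n \<omega>) \<and> hits T (x n \<omega>) (Z n \<omega>))} \<in> sets M" (is "?E \<in> _")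
    and "hit_intensity S T < \<infinity>"
    and "measure M {\<omega> \<in> space M. \<forall>n. \<not> (hits S (x n \<omega>) (Z n \<omega>) \<and> hits T (x n \<omega>) (Z n \<omega>))}
       = exp (- enn2real (hit_intensity S T))"
proof -
  let ?p = "\<lambda>y. measure Q (Pair y -` hit_both S T)"
  have H: "hit_both S T \<in> sets (borel \<Otimes>\<^sub>M convex_bodies)" by (rule hit_both_sets) fact+
  have HQ: "hit_both S T \<in> sets (lborel \<Otimes>\<^sub>M Q)"
    using H by (simp cong: sets_pair_measure_cong add: sets_Q)
  have Zs: "Z n \<omega> \<in> space convex_bodies" if "\<omega> \<in> space M" for n \<omega>
    using grains that measurable_space unfolding iid_grains_def by metis
  have E: "?E = {\<omega> \<in> space M. \<forall>n. (x n \<omega>, Z n \<omega>) \<notin> hit_both S T}"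
    using Zs by (auto simp: hit_both_def space_pair_measure)
  have outside: "?p y = 0" if "y \<notin> cball 0 (r + D)" for y
  proof -
    have "AE L in Q. L \<notin> Pair y -` hit_both S T"
      using Q_bounded
    proof eventually_elim
      case (elim L)
      show ?case
      proof
        assume "L \<in> Pair y -` hit_both S T"
        then obtain z where z: "z \<in> L" "y + z \<in> S" by (auto simp: hit_both_def hits_def)
        have "norm y \<le> norm (y + z) + norm z" using norm_triangle_ineq4[of "y + z" z] by simp
        also have "\<dots> \<le> r + D" using subsetD[OF r z(2)] subsetD[OF elim z(1)] by simp
        finally show False using that by simp
      qed
    qed
    thus ?thesis using Q.prob_eq_0 sets_Pair1[OF HQ] by blast
  qed
  have p1: "?p y \<le> 1" for y by simp
  have pm: "?p \<in> borel_measurable borel"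
    unfolding measure_def
    by (intro borel_measurable_enn2real Q.measurable_emeasure_Pair) (use HQ in \<open>simp cong: sets_pair_measure_cong\<close>)
  interpret P: pair_sigma_finite lborel Q ..
  have "(\<integral>\<^sup>+ y. ennreal (?p y) \<partial>lborel) = emeasure (lborel \<Otimes>\<^sub>M Q) (hit_both S T)"
    by (subst Q.emeasure_pair_measure_alt[OF HQ]) (simp add: Q.emeasure_eq_measure)
  also have "\<dots> = (\<integral>\<^sup>+ L. emeasure lborel ((\<lambda>y. (y, L)) -` hit_both S T) \<partial>Q)"
    by (rule P.emeasure_pair_measure_alt2[OF HQ])
  also have "\<dots> = (\<integral>\<^sup>+ L. emeasure lborel {y. hits S y L \<and> hits T y L} \<partial>Q)"
    by (intro nn_integral_cong) (simp add: hit_both_section space_Q)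
  also have "\<dots> = hit_intensity S T"
    unfolding hit_intensity_def Q_def
    by (rule nn_integral_distr) (use hit_emeasure_measurable[OF S T] K in auto)
  finally have eq: "(\<integral>\<^sup>+ y. ennreal (?p y) \<partial>lborel) = hit_intensity S T" .
  have "(\<integral>\<^sup>+ y. ennreal (?p y) \<partial>lborel) \<le> (\<integral>\<^sup>+ y. indicator (cball (0 :: real^2) (r + D)) y \<partial>lborel)"
    by (intro nn_integral_mono) (use outside p1 in \<open>auto simp: indicator_def\<close>)
  also have "\<dots> < \<infinity>" using emeasure_bounded_finite[of "cball (0 :: real^2) (r + D)"] by simp
  finally show "hit_intensity S T < \<infinity>" unfolding eq .
  have int: "(\<integral>y. ?p y \<partial>lborel) = enn2real (hit_intensity S T)"
    unfolding eq[symmetric] by (rule integral_eq_nn_integral) (use pm in auto)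
  show "?E \<in> sets M"
    unfolding E by (rule void_probability(1)[OF M.prob_space_axioms X grains H, of "cball 0 (r + D)"]) (use outside in \<open>auto simp: Q_def\<close>)
  show "measure M ?E = exp (- enn2real (hit_intensity S T))"
    unfolding E int[symmetric] unfolding Q_def
    by (rule void_probability(2)[OF M.prob_space_axioms X grains H, of "cball 0 (r + D)"]) (use outside in \<open>auto simp: Q_def\<close>)
qed


definition free_event :: "(real^2) set \<Rightarrow> 'w set" where
  "free_event S = {\<omega> \<in> space M. \<forall>n. \<not> hits S (x n \<omega>) (Z n \<omega>)}"

lemma free_event_sets [measurable]: "compact S \<Longrightarrow> free_event S \<in> sets M"
proof -
  assume S: "compact S"
  then obtain r where "\<forall>y\<in>S. norm y \<le> r"
    using compact_imp_bounded[OF S] unfolding bounded_iff by (elim exE)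
  hence "S \<subseteq> cball 0 r" by auto
  with no_hit_prob(1)[of S S r] S show ?thesis by (simp add: free_event_def compact_imp_closed)
qed

lemma free_ray_prob:
  assumes "0 \<le> r"
  shows "exp (- ((r + 2 * D) * expected_width)) \<le> measure M (free_event (ray r 0))"
proof -
  \<comment> \<open>\<open>D\<close> is nonnegative because the ball of radius \<open>D\<close>
    contains a grain that contains the origin.\<close>
  have "AE \<omega> in N. 0 \<le> D" using zero_in_K K_bounded by eventually_elim auto
  hence D: "0 \<le> D" by simp
  have "hit_intensity (ray r 0) (ray r 0) \<le> (\<integral>\<^sup>+ \<omega>. ennreal ((r + 2 * D) * width_orth (dirv 0) (K \<omega>)) \<partial>N)"
    unfolding hit_intensity_def
    by (rule nn_integral_mono_AE) (use K_bounded AE_space in \<open>eventually_elim, use hits_ray_subset_cbox[OF convex_body_K _ assms] in simp\<close>)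
  also have "\<dots> = ennreal (\<integral>\<omega>. (r + 2 * D) * width_orth (dirv 0) (K \<omega>) \<partial>N)"
  proof (rule nn_integral_eq_integral)
    show "AE \<omega> in N. 0 \<le> (r + 2 * D) * width_orth (dirv 0) (K \<omega>)"
    proof (rule AE_I2)
      fix \<omega> assume "\<omega> \<in> space N"
      thus "0 \<le> (r + 2 * D) * width_orth (dirv 0) (K \<omega>)"
        using width_orth_bounds(2)[OF convex_body_K] assms D by simp
    qed
  qed (intro integrable_mult_right integrable_width)
  also have "\<dots> = ennreal ((r + 2 * D) * expected_width)" by (simp add: expected_width_def)
  finally have "enn2real (hit_intensity (ray r 0) (ray r 0)) \<le> (r + 2 * D) * expected_width"
    using D assms expected_width_nonneg by (intro enn2real_leI) auto
  moreover have "measure M (free_event (ray r 0)) = exp (- enn2real (hit_intensity (ray r 0) (ray r 0)))"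
    using no_hit_prob(3)[OF closed_ray closed_ray ray_subset_cball, of r 0 r 0] by (simp add: free_event_def)
  ultimately show ?thesis by simp
qed

text \<open>The two segments are the rotation by \<open>a\<close> of a pair starting at angle 0. For
  that pair the area bound, affine in the width, integrates to the exponent.\<close>

lemma no_common_grain_prob:
  assumes s: "0 \<le> s" "2 * D \<le> s * cos t" and t: "0 \<le> t" "t < pi / 2"
  shows "measure M {\<omega> \<in> space M. \<forall>n. \<not> (hits (ray s a) (x n \<omega>) (Z n \<omega>) \<and> hits (ray s (a + t)) (x n \<omega>) (Z n \<omega>))}
    \<le> exp (- ((s * cos t - 2 * D) * (expected_width - s * sin t)))"
proof -
  let ?g = "\<lambda>\<omega>. (s * cos t - 2 * D) * (width_orth (dirv 0) (K \<omega>) - s * sin t)"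
  have int: "integrable N ?g"
    by (intro integrable_mult_right Bochner_Integration.integrable_diff integrable_width) simp
  have "ennreal ((s * cos t - 2 * D) * (expected_width - s * sin t)) = ennreal (\<integral>\<omega>. ?g \<omega> \<partial>N)"
    using integrable_width by (simp add: expected_width_def N.prob_space)
  \<comment> \<open>The area bound may be negative for grains narrower than
    \<open>s * sin t\<close>, where \<open>ennreal\<close> truncates it to 0; passing to the
    positive part only increases the integral.\<close>
  also have "\<dots> \<le> ennreal (\<integral>\<omega>. max 0 (?g \<omega>) \<partial>N)"
    using int by (intro ennreal_leI integral_mono) auto
  also have "\<dots> = (\<integral>\<^sup>+ \<omega>. ennreal (max 0 (?g \<omega>)) \<partial>N)"
    by (rule nn_integral_eq_integral[symmetric]) (use int in auto)
  also have "\<dots> = (\<integral>\<^sup>+ \<omega>. ennreal (?g \<omega>) \<partial>N)"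
    by (intro nn_integral_cong) (simp add: max_def ennreal_neg)
  also have "\<dots> \<le> hit_intensity (ray s 0) (ray s t)"
    unfolding hit_intensity_def
  proof (rule nn_integral_mono_AE)
    show "AE \<omega> in N. ennreal (?g \<omega>) \<le> emeasure lborel {y. hits (ray s 0) y (K \<omega>) \<and> hits (ray s t) y (K \<omega>)}"
      using K_bounded AE_space
      by eventually_elim
        (intro hits_two_rays_lower_bound convex_body_K hit_points_sets closed_ray s t, auto)
  qed
  also have "\<dots> = hit_intensity (ray s a) (ray s (a + t))"
    using hit_intensity_rot[of "ray s 0" "ray s t" a] closed_ray[of s a] closed_ray[of s "a + t"]
    by (simp add: ray_rot[symmetric] closed_ray)
  finally have "ennreal ((s * cos t - 2 * D) * (expected_width - s * sin t))
      \<le> ennreal (enn2real (hit_intensity (ray s a) (ray s (a + t))))"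
    using no_hit_prob(2)[OF closed_ray[of s a] closed_ray[of s "a + t"] ray_subset_cball] by simp
  hence "(s * cos t - 2 * D) * (expected_width - s * sin t) \<le> enn2real (hit_intensity (ray s a) (ray s (a + t)))"
    by (subst (asm) ennreal_le_iff) simp_all
  thus ?thesis
    using no_hit_prob(3)[OF closed_ray[of s a] closed_ray[of s "a + t"] ray_subset_cball] by simp
qed

section \<open>The visibility event and a measurable substitute\<close>

definition visible_event :: "real \<Rightarrow> 'w set" where
  "visible_event r = {\<omega> \<in> space M. ereal r \<le> total_visibility (occupied (\<lambda>n. x n \<omega>) (\<lambda>n. Z n \<omega>))
      \<and> 0 \<notin> occupied (\<lambda>n. x n \<omega>) (\<lambda>n. Z n \<omega>)}"

text \<open>A measurable version of \<open>visible_event\<close>: almost surely, whether a ray is free does not change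
  under small rotations, so rational angles suffice.\<close>

definition rational_event :: "real \<Rightarrow> 'w set" where
  "rational_event r = (\<Inter>j. \<Union>q\<in>\<rat> \<inter> {0..<2 * pi}. free_event (ray (r - 1 / real (Suc j)) q))"

lemma rational_event_sets [measurable]: "rational_event r \<in> sets M"
  unfolding rational_event_def
  by (intro sets.countable_INT sets.countable_UN'' image_subsetI free_event_sets compact_ray)
    (auto intro: countable_rat countable_subset)

lemma free_event_iff:
  "\<omega> \<in> free_event S \<longleftrightarrow> \<omega> \<in> space M \<and> occupied (\<lambda>n. x n \<omega>) (\<lambda>n. Z n \<omega>) \<inter> S = {}"
  unfolding free_event_def occupied_disjoint_iff by simp

text \<open>Total visibility at least \<open>r\<close> yields free segments of all lengths below
  \<open>r\<close>, hence the lengths \<open>r - 1 / real (Suc j)\<close>; conversely, free segments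
  of these lengths push the supremum up to \<open>r\<close>. For \<open>1 \<le> r\<close> each of
  them has nonnegative length and so contains the origin, which is therefore unoccupied.\<close>

lemma visible_event_AE:
  assumes r: "1 \<le> r"
  shows "AE \<omega> in M. \<omega> \<in> visible_event r \<longleftrightarrow> \<omega> \<in> rational_event r"
proof -
  have bij: "AE \<omega> in M. bij_betw (\<lambda>n. x n \<omega>) UNIV (X \<omega>)"
    using grains by (simp add: iid_grains_def)
  have fin: "AE \<omega> in M. \<forall>B. bounded B \<longrightarrow> finite (X \<omega> \<inter> B)"
    using X by (simp add: unit_poisson_process_def)
  show ?thesis
    using bij fin AE_grains AE_space
  proof eventually_elim
    case (elim \<omega>)
    let ?O = "occupied (\<lambda>n. x n \<omega>) (\<lambda>n. Z n \<omega>)"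
    have fin: "finite {n. x n \<omega> \<in> cball 0 R}" for R
    proof -
      have "(\<lambda>n. x n \<omega>) ` {n. x n \<omega> \<in> cball 0 R} \<subseteq> X \<omega> \<inter> cball 0 R"
        using elim(1) by (auto simp: bij_betw_def)
      moreover have "finite (X \<omega> \<inter> cball 0 R)" using elim(2) bounded_cball by blast
      ultimately have "finite ((\<lambda>n. x n \<omega>) ` {n. x n \<omega> \<in> cball 0 R})" by (rule finite_subset)
      thus ?thesis by (rule finite_imageD) (use elim(1) in \<open>auto simp: bij_betw_def inj_on_def\<close>)
    qed
    show ?case
    proof
      assume vis: "\<omega> \<in> visible_event r"
      have "\<exists>q\<in>\<rat> \<inter> {0..<2 * pi}. \<omega> \<in> free_event (ray (r - 1 / real (Suc j)) q)" for j
      proof -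
        have "ereal (r - 1 / real (Suc j)) < ereal r" by simp
        also have "\<dots> \<le> total_visibility ?O" using vis by (simp add: visible_event_def)
        finally obtain t where t: "0 \<le> t" "t < 2 * pi" "?O \<inter> ray (r - 1 / real (Suc j)) t = {}"
          using total_visibility_gt_imp vis unfolding visible_event_def by blast
        obtain q where "q \<in> \<rat>" "0 \<le> q" "q < 2 * pi" "?O \<inter> ray (r - 1 / real (Suc j)) q = {}"
          by (rule free_ray_rational[OF _ _ fin t]) (use elim(3) in auto)
        thus ?thesis using elim(4) by (auto simp: free_event_iff)
      qed
      thus "\<omega> \<in> rational_event r" by (auto simp: rational_event_def)
    next
      assume rat: "\<omega> \<in> rational_event r"
      have free: "\<exists>q. ?O \<inter> ray (r - 1 / real (Suc j)) q = {}" for j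
        using rat by (auto simp: rational_event_def free_event_iff)
      have ge: "ereal (r - 1 / real (Suc j)) \<le> total_visibility ?O" for j
        using free[of j] total_visibility_ge by blast
      have lim: "(\<lambda>j. ereal (r - 1 / real (Suc j))) \<longlonglongrightarrow> ereal r"
        by (intro tendsto_ereal) real_asymp
      have "ereal r \<le> total_visibility ?O"
        by (rule LIMSEQ_le_const2[OF lim]) (use ge in blast)
      moreover have "0 \<in> ray (r - 1 / real (Suc 0)) q" for q
        unfolding ray_def using r by (intro image_eqI[of _ _ 0]) auto
      hence "0 \<notin> ?O" using free[of 0] by blast
      ultimately show "\<omega> \<in> visible_event r" using elim(4) by (simp add: visible_event_def)
    qed
  qed
qed

text \<open>The two events differ only by subsets of null sets. These belong to the completion, so
  the visibility event is measurable there and has the same probability.\<close>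

lemma visible_event_completion:
  assumes "1 \<le> r"
  shows "measure (completion M) (visible_event r) = measure M (rational_event r)"
proof -
  have AE: "AE \<omega> in completion M. \<omega> \<in> rational_event r \<longleftrightarrow> \<omega> \<in> visible_event r"
    using AE_completion[OF visible_event_AE[OF assms]] by eventually_elim simp
  have n1: "AE \<omega> in M. \<not> (\<omega> \<in> visible_event r \<and> \<omega> \<notin> rational_event r)"
    and n2: "AE \<omega> in M. \<not> (\<omega> \<in> rational_event r \<and> \<omega> \<notin> visible_event r)"
    using visible_event_AE[OF assms] by (eventually_elim, simp)+
  have "{\<omega> \<in> space M. \<omega> \<in> visible_event r \<and> \<omega> \<notin> rational_event r} \<in> sets (completion M)" (is "?A \<in> _")
    using sets_completion_AE[OF n1] by (simp add: pred_def)
  moreover have "{\<omega> \<in> space M. \<omega> \<in> rational_event r \<and> \<omega> \<notin> visible_event r} \<in> sets (completion M)" (is "?B \<in> _")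
    using sets_completion_AE[OF n2] by (simp add: pred_def)
  moreover have "rational_event r \<in> sets (completion M)" by simp
  ultimately have "(rational_event r - ?B) \<union> ?A \<in> sets (completion M)" by (intro sets.Un sets.Diff)
  moreover have "(rational_event r - ?B) \<union> ?A = visible_event r"
    using sets.sets_into_space[OF rational_event_sets[of r]] by (auto simp: visible_event_def)
  ultimately have "visible_event r \<in> sets (completion M)" by (simp only:)
  with AE have "measure (completion M) (rational_event r) = measure (completion M) (visible_event r)"
    by (intro measure_eq_AE) auto
  thus ?thesis by simp
qed

section \<open>Exponential bounds on the visibility probability\<close>

lemma visible_event_lower:
  assumes "1 \<le> r"
  shows "exp (- ((r + 2 * D) * expected_width)) \<le> measure M (rational_event r)"
proof -
  have "free_event (ray r 0) \<subseteq> rational_event r"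
  proof
    fix \<omega> assume *: "\<omega> \<in> free_event (ray r 0)"
    have "ray (r - 1 / real (Suc j)) 0 \<subseteq> ray r 0" for j
      unfolding ray_def by (intro image_mono) auto
    hence "\<omega> \<in> free_event (ray (r - 1 / real (Suc j)) 0)" for j
      using * unfolding free_event_iff by blast
    thus "\<omega> \<in> rational_event r" unfolding rational_event_def by (auto intro!: bexI[of _ 0])
  qed
  hence "measure M (free_event (ray r 0)) \<le> measure M (rational_event r)"
    by (rule M.finite_measure_mono) simp
  with free_ray_prob[of r] assms show ?thesis by simp
qed

text \<open>The member \<open>j = 0\<close> of the intersection supplies a free segment of length
  \<open>r - 1\<close>, a shortening that does not affect the rate. The bound \<open>4 < m\<close>
  keeps the sector angle below \<open>pi / 2\<close>, as the area estimate requires, and so below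
  \<open>pi\<close>, as the sector argument requires.\<close>

lemma visible_event_upper:
  fixes m :: nat
  assumes r: "1 \<le> r" and m: "4 < m" and D: "2 * D \<le> (r - 1) * cos (2 * pi / m)"
  shows "measure M (rational_event r)
    \<le> m * exp (- (((r - 1) * cos (2 * pi / m) - 2 * D) * (expected_width - (r - 1) * sin (2 * pi / m))))"
proof -
  let ?t = "2 * pi / real m"
  let ?F = "\<lambda>i. {\<omega> \<in> space M. \<forall>n. \<not> (hits (ray (r - 1) (real i * ?t)) (x n \<omega>) (Z n \<omega>)
      \<and> hits (ray (r - 1) (real i * ?t + ?t)) (x n \<omega>) (Z n \<omega>))}"
  have t: "0 \<le> ?t" "?t < pi / 2" using m by (auto simp: field_simps)
  have F: "?F i \<in> sets M" for i
    by (rule no_hit_prob(1)[OF closed_ray closed_ray ray_subset_cball])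
  have Zc: "convex (Z n \<omega>)" if "\<omega> \<in> space M" for n \<omega>
  proof -
    have "Z n \<in> measurable M convex_bodies" using grains by (simp add: iid_grains_def)
    from measurable_space[OF this that] show ?thesis by (simp add: space_convex_bodies convex_body_def)
  qed
  have "rational_event r \<subseteq> (\<Union>i<m. ?F i)"
  proof
    fix \<omega> assume "\<omega> \<in> rational_event r"
    hence "\<omega> \<in> (\<Union>q\<in>\<rat> \<inter> {0..<2 * pi}. free_event (ray (r - 1 / real (Suc 0)) q))"
      unfolding rational_event_def by (rule INT_D) simp
    then obtain q where q: "0 \<le> q" "q < 2 * pi" "\<omega> \<in> free_event (ray (r - 1) q)" by auto
    obtain i where i: "i < m" "real i * ?t \<le> q" "q \<le> real i * ?t + ?t"
      using sector_exists[of m q] m q by auto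
    have \<omega>: "\<omega> \<in> space M" using q(3) by (simp add: free_event_def)
    have "hits (ray (r - 1) q) (x n \<omega>) (Z n \<omega>)"
      if "hits (ray (r - 1) (real i * ?t)) (x n \<omega>) (Z n \<omega>)" "hits (ray (r - 1) (real i * ?t + ?t)) (x n \<omega>) (Z n \<omega>)" for n
      by (rule hits_intermediate_ray[OF Zc[OF \<omega>] that i(2,3)]) (use t pi_gt_zero in linarith)
    hence "\<omega> \<in> ?F i" using q(3) \<omega> unfolding free_event_def by blast
    thus "\<omega> \<in> (\<Union>i<m. ?F i)" using i(1) by blast
  qed
  hence "measure M (rational_event r) \<le> measure M (\<Union>i<m. ?F i)"
    by (rule M.finite_measure_mono) (use F in auto)
  also have "\<dots> \<le> (\<Sum>i<m. measure M (?F i))"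
    by (rule M.finite_measure_subadditive_finite) (use F in auto)
  also have "\<dots> \<le> (\<Sum>i<m. exp (- (((r - 1) * cos ?t - 2 * D) * (expected_width - (r - 1) * sin ?t))))"
    by (intro sum_mono no_common_grain_prob) (use r D t in auto)
  finally show ?thesis by simp
qed

end

text \<open>With about \<open>r ^ 2\<close> sectors, \<open>ln (m r)\<close> is of order
  \<open>ln r\<close>, negligible against \<open>r\<close>, and
  \<open>(r - 1) * sin (2 * pi / m r)\<close> is of order at most \<open>1 / r\<close>. The constant
  \<open>c\<close> will be the logarithm of the probability of the conditioning event.\<close>

lemma upper_rate_limit:
  fixes w D c :: real
  defines "m \<equiv> (\<lambda>r::real. nat \<lceil>r ^ 2\<rceil>)"
  shows "((\<lambda>r. 1 / r * (ln (m r) - ((r - 1) * cos (2 * pi / m r) - 2 * D) * (w - (r - 1) * sin (2 * pi / m r)) - c))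
      \<longlongrightarrow> - w) at_top"
    and "\<forall>\<^sub>F r in at_top. 2 * D \<le> (r - 1) * cos (2 * pi / m r)"
    and "\<forall>\<^sub>F r in at_top. 4 < m r"
proof -
  show "\<forall>\<^sub>F r in at_top. 4 < m r" unfolding m_def by real_asymp
  have t: "((\<lambda>r. 2 * pi / m r) \<longlongrightarrow> 0) at_top" unfolding m_def by real_asymp
  have cos: "((\<lambda>r. cos (2 * pi / m r)) \<longlongrightarrow> 1) at_top" using tendsto_cos[OF t] by simp
  have sin: "((\<lambda>r. (r - 1) * sin (2 * pi / m r)) \<longlongrightarrow> 0) at_top"
  proof (rule Lim_null_comparison)
    show "\<forall>\<^sub>F r in at_top. norm ((r - 1) * sin (2 * pi / m r)) \<le> (r - 1) * (2 * pi / m r)"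
      using eventually_ge_at_top[of 1]
    proof eventually_elim
      case (elim r)
      have "\<bar>sin (2 * pi / m r)\<bar> \<le> 2 * pi / m r" using abs_sin_x_le_abs_x[of "2 * pi / m r"] by simp
      thus ?case using elim by (simp add: abs_mult mult_left_mono del: times_divide_eq_right)
    qed
    show "((\<lambda>r. (r - 1) * (2 * pi / m r)) \<longlongrightarrow> 0) at_top" unfolding m_def by real_asymp
  qed
  have "filterlim (\<lambda>r. cos (2 * pi / m r) * (r - 1)) at_top at_top"
    by (rule filterlim_tendsto_pos_mult_at_top[OF cos]) (simp, real_asymp)
  thus "\<forall>\<^sub>F r in at_top. 2 * D \<le> (r - 1) * cos (2 * pi / m r)"
    unfolding filterlim_at_top by (simp add: mult.commute)
  have "((\<lambda>r. ln (m r) / r - ((r - 1) / r * cos (2 * pi / m r) - 2 * D / r) * (w - (r - 1) * sin (2 * pi / m r)) - c / r)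
      \<longlongrightarrow> 0 - (1 * 1 - 0) * (w - 0) - 0) at_top"
  proof (intro tendsto_diff tendsto_mult cos sin tendsto_const)
    show "((\<lambda>r. ln (m r) / r) \<longlongrightarrow> 0) at_top" unfolding m_def by real_asymp
  qed real_asymp+
  moreover have "\<forall>\<^sub>F r in at_top. ln (m r) / r - ((r - 1) / r * cos (2 * pi / m r) - 2 * D / r) * (w - (r - 1) * sin (2 * pi / m r)) - c / r
      = 1 / r * (ln (m r) - ((r - 1) * cos (2 * pi / m r) - 2 * D) * (w - (r - 1) * sin (2 * pi / m r)) - c)"
    using eventually_gt_at_top[of 0]
  proof eventually_elim
    case (elim r)
    have "L / r - ((r - 1) / r * C - 2 * D / r) * V - c / r = 1 / r * (L - ((r - 1) * C - 2 * D) * V - c)" for L C V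
      using elim by (simp add: field_simps)
    thus ?case .
  qed
  ultimately show "((\<lambda>r. 1 / r * (ln (m r) - ((r - 1) * cos (2 * pi / m r) - 2 * D) * (w - (r - 1) * sin (2 * pi / m r)) - c))
      \<longlongrightarrow> - w) at_top"
    by (simp add: filterlim_cong)
qed

section \<open>The limit of the conditional log-probability\<close>

context planar_boolean_model
begin

lemma cond_visibility_limit:
  "((\<lambda>r::real. 1 / r *
            ln (cond_prob (completion M)
                  (\<lambda>\<omega>. total_visibility (occupied (\<lambda>n. x n \<omega>) (\<lambda>n. Z n \<omega>)) \<ge> ereal r)
                  (\<lambda>\<omega>. 0 \<notin> occupied (\<lambda>n. x n \<omega>) (\<lambda>n. Z n \<omega>))))
          \<longlongrightarrow> - expected_width) at_top"
proof -
  define P0 where "P0 = measure M (free_event {0})"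
  define A where "A = (\<lambda>r. measure M (rational_event r))"
  define m where "m = (\<lambda>r::real. nat \<lceil>r ^ 2\<rceil>)"
  have origin: "{\<omega> \<in> space M. 0 \<notin> occupied (\<lambda>n. x n \<omega>) (\<lambda>n. Z n \<omega>)} = free_event {0}"
    by (auto simp: free_event_iff)
  have cond: "cond_prob (completion M)
      (\<lambda>\<omega>. total_visibility (occupied (\<lambda>n. x n \<omega>) (\<lambda>n. Z n \<omega>)) \<ge> ereal r)
      (\<lambda>\<omega>. 0 \<notin> occupied (\<lambda>n. x n \<omega>) (\<lambda>n. Z n \<omega>)) = A r / P0" if "1 \<le> r" for r
    using visible_event_completion[OF that] free_event_sets[of "{0}"]
    by (simp add: cond_prob_def visible_event_def A_def P0_def origin)
  \<comment> \<open>A free segment of length 1 leaves the origin free and has positive probability,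
    so the conditioning event has positive probability.\<close>
  have "free_event (ray 1 0) \<subseteq> free_event {0}"
  proof -
    have "(0 :: real^2) \<in> ray 1 0" unfolding ray_def by (intro image_eqI[of _ _ 0]) auto
    thus ?thesis by (auto simp: free_event_iff)
  qed
  hence "measure M (free_event (ray 1 0)) \<le> P0"
    unfolding P0_def by (rule M.finite_measure_mono) simp
  moreover have "0 < measure M (free_event (ray 1 0))"
    using free_ray_prob[of 1] by (intro less_le_trans[OF exp_gt_zero]) auto
  ultimately have P0: "0 < P0" by linarith
  have P0_1: "P0 \<le> 1" by (simp add: P0_def)
  have low: "exp (- ((r + 2 * D) * expected_width)) \<le> A r" if "1 \<le> r" for r
    using visible_event_lower[OF that] by (simp add: A_def)
  have pos: "0 < A r" if "1 \<le> r" for r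
    using low[OF that] by (rule less_le_trans[OF exp_gt_zero])
  have "((\<lambda>r. 1 / r * ln (A r / P0)) \<longlongrightarrow> - expected_width) at_top"
  proof (rule real_tendsto_sandwich)
    show "((\<lambda>r. 1 / r * (- ((r + 2 * D) * expected_width))) \<longlongrightarrow> - expected_width) at_top"
    proof -
      have "((\<lambda>r. 1 / r * (- ((r + 2 * D) * w))) \<longlongrightarrow> - w) at_top" for w :: real
        by real_asymp
      thus ?thesis .
    qed
    show "((\<lambda>r. 1 / r * (ln (m r) - ((r - 1) * cos (2 * pi / m r) - 2 * D)
        * (expected_width - (r - 1) * sin (2 * pi / m r)) - ln P0)) \<longlongrightarrow> - expected_width) at_top"
      unfolding m_def by (rule upper_rate_limit)
    show "\<forall>\<^sub>F r in at_top. 1 / r * (- ((r + 2 * D) * expected_width)) \<le> 1 / r * ln (A r / P0)"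
      using eventually_ge_at_top[of 1]
    proof eventually_elim
      case (elim r)
      have "- ((r + 2 * D) * expected_width) \<le> ln (A r)"
        using low[OF elim] pos[OF elim] by (simp add: ln_ge_iff)
      \<comment> \<open>Dividing by \<open>P0 \<le> 1\<close> can only raise the probability, so the
        lower bound survives the conditioning.\<close>
      also have "\<dots> \<le> ln (A r / P0)"
        using pos[OF elim] P0 P0_1 ln_le_zero_iff[of P0] by (simp add: ln_div)
      finally show ?case using elim by (intro mult_left_mono) auto
    qed
    show "\<forall>\<^sub>F r in at_top. 1 / r * ln (A r / P0) \<le> 1 / r * (ln (m r) - ((r - 1) * cos (2 * pi / m r) - 2 * D)
        * (expected_width - (r - 1) * sin (2 * pi / m r)) - ln P0)"
      using eventually_ge_at_top[of 1] upper_rate_limit(2)[of D] upper_rate_limit(3)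
    proof eventually_elim
      case (elim r)
      let ?e = "((r - 1) * cos (2 * pi / m r) - 2 * D) * (expected_width - (r - 1) * sin (2 * pi / m r))"
      have "A r \<le> m r * exp (- ?e)"
        unfolding A_def using elim by (intro visible_event_upper) (simp_all add: m_def)
      hence "ln (A r) \<le> ln (m r * exp (- ?e))"
        using pos[OF elim(1)] by simp
      also have "\<dots> = ln (m r) - ?e" using elim by (subst ln_mult) (auto simp: m_def)
      finally have "ln (A r / P0) \<le> ln (m r) - ?e - ln P0"
        using pos[OF elim(1)] P0 by (simp add: ln_div)
      thus ?case using elim by (intro mult_left_mono) auto
    qed
  qed
  moreover have "\<forall>\<^sub>F r in at_top. 1 / r * ln (A r / P0) = 1 / r * ln (cond_prob (completion M)
      (\<lambda>\<omega>. total_visibility (occupied (\<lambda>n. x n \<omega>) (\<lambda>n. Z n \<omega>)) \<ge> ereal r)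
      (\<lambda>\<omega>. 0 \<notin> occupied (\<lambda>n. x n \<omega>) (\<lambda>n. Z n \<omega>)))"
    using eventually_ge_at_top[of 1] by eventually_elim (simp add: cond)
  ultimately show ?thesis by (rule Lim_transform_eventually)
qed

end

theorem theorem3p2:
  fixes M :: "'w measure" and N :: "'v measure"
    and K :: "'v \<Rightarrow> (real^2) set"
    and X :: "'w \<Rightarrow> (real^2) set"
    and x :: "nat \<Rightarrow> 'w \<Rightarrow> real^2"
    and Z :: "nat \<Rightarrow> 'w \<Rightarrow> (real^2) set"
    and D :: real
  assumes "prob_space N"
    and "K \<in> measurable N convex_bodies"
    and "AE \<omega> in N. 0 \<in> K \<omega>"
    and "\<And>R :: real^2^2. rotation_matrix R \<Longrightarrow>
           distr N convex_bodies (\<lambda>\<omega>. (\<lambda>y. R *v y) ` K \<omega>) = distr N convex_bodies K"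
    and "D > 0"
    and "AE \<omega> in N. diameter (K \<omega>) \<le> D"
    and "prob_space M"
    and "unit_poisson_process M X"
    and "iid_grains M X (distr N convex_bodies K) x Z"
  shows "((\<lambda>r::real. 1 / r *
            ln (cond_prob (completion M)
                  (\<lambda>\<omega>. total_visibility (occupied (\<lambda>n. x n \<omega>) (\<lambda>n. Z n \<omega>)) \<ge> ereal r)
                  (\<lambda>\<omega>. 0 \<notin> occupied (\<lambda>n. x n \<omega>) (\<lambda>n. Z n \<omega>))))
          \<longlongrightarrow> - (\<integral>\<omega>. mean_width (K \<omega>) \<partial>N)) at_top"
proof -
  interpret planar_boolean_model N M K X x Z D
    using assms by (intro planar_boolean_model.intro planar_boolean_model_axioms.intro)
  show ?thesis unfolding integral_mean_width by (rule cond_visibility_limit)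
qed

end
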